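(* For every coloured ribbon graph $\mathbb{G}$, $T_{ps}(\mathbb{G}^*;w,x,y,z)=T_{ps}(\mathbb{G};y,z,w,x)$.
   Context: A ribbon graph $\mathbb{G}=(V,E)$ is a surface with boundary represented as a union of two finite sets of closed discs, vertices and edges, meeting in disjoint line segments, each on the boundary of exactly one vertex and one edge, each edge containing exactly two such segments; $F(\mathbb{G})$ is its set of boundary components. The geometric dual $\mathbb{G}^*$ is obtained by capping off each boundary component of $\mathbb{G}$ with a disc; these discs are the vertices of $\mathbb{G}^*$ and the edges are those of $\mathbb{G}$; vertices of $\mathbb{G}^*$ correspond to boundary components of $\mathbb{G}$ and boundary components of $\mathbb{G}^*$ to vertices of $\mathbb{G}$. A coloured ribbon graph is a ribbon graph with a partition $\mathcal{V}$ of $V$ into vertex colour classes and a partition $\mathcal{B}$ of $F(\mathbb{G})$ into boundary colour classes. The dual of a coloured ribbon graph is $\mathbb{G}^*$ with vertex colouring induced from the boundary colouring of $\mathbb{G}$ and boundary colouring induced from the vertex colouring of $\mathbb{G}$. Parameters: for a graph $H$, $r_H(A)$ is the rank (vertices minus components) of the spanning subgraph with edge set $A$. $b(A)$ = number of boundary components of ribbon subgraph $(V,A)$; $\rho(A)=\frac12(|A|+|V|-b(A))$. $\mathbb{G}/\mathcal{V}$: graph on the vertex colour classes with an edge for each edge of $\mathbb{G}$ joining the classes of its ends. $\mathbb{G}^*/\mathcal{B}$: graph on the boundary colour classes with an edge for each edge $e$ joining the classes of the boundary components touching $e$. $r_1(A)=r_{\mathbb{G}/\mathcal{V}}(A)$,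 $r_2(A)=\rho(A)-r_{\mathbb{G}/\mathcal{V}}(A)$, $r_3(A)=r_{\mathbb{G}^*/\mathcal{B}}(E)-r_{\mathbb{G}^*/\mathcal{B}}(E\setminus A)$, $r_4(A)=|A|+r_{\mathbb{G}^*/\mathcal{B}}(E\setminus A)-r_{\mathbb{G}^*/\mathcal{B}}(E)-\rho(A)$. The Tutte polynomial of a coloured ribbon graph is $T_{ps}(\mathbb{G};w,x,y,z)=\sum_{A\subseteq E}w^{r_1(E)-r_1(A)}x^{r_2(E)-r_2(A)}y^{r_3(A)}z^{r_4(A)}$ (all quantities computed in $\mathbb{G}$ with its colourings). *)

theory Defs
  imports "HOL-Analysis.Analysis" "HOL-Library.Poly_Mapping"
begin

section \<open>Surfaces with boundary and discs\<close>

text \<open>Surfaces are abstract topologies; the plane is modelled by the type \<^typ>\<open>complex\<close>.\<close>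

definition surface_with_boundary :: "'a topology \<Rightarrow> bool" where
  "surface_with_boundary X \<longleftrightarrow>
     Hausdorff_space X \<and>
     (\<exists>\<B>. countable \<B> \<and> (\<forall>B\<in>\<B>. openin X B) \<and>
          (\<forall>U x. openin X U \<and> x \<in> U \<longrightarrow> (\<exists>B\<in>\<B>. x \<in> B \<and> B \<subseteq> U))) \<and>
     (\<forall>x\<in>topspace X. \<exists>U W.
        openin X U \<and> x \<in> U \<and> openin (top_of_set {z::complex. 0 \<le> Im z}) W \<and>
        subtopology X U homeomorphic_space top_of_set W)"

text \<open>The manifold boundary: the points without a neighbourhood homeomorphic to the plane.\<close>

definition surface_boundary :: "'a topology \<Rightarrow> 'a set" where
  "surface_boundary X =
     {x \<in> topspace X. \<not> (\<exists>U. openin X U \<and> x \<in> U \<and>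
        subtopology X U homeomorphic_space (euclidean :: complex topology))}"

definition is_closed_disc :: "'a topology \<Rightarrow> 'a set \<Rightarrow> bool" where
  "is_closed_disc X d \<longleftrightarrow> d \<subseteq> topspace X \<and>
     subtopology X d homeomorphic_space top_of_set (cball (0::complex) 1)"

definition disc_boundary :: "'a topology \<Rightarrow> 'a set \<Rightarrow> 'a set" where
  "disc_boundary X d = surface_boundary (subtopology X d)"

definition is_line_segment :: "'a topology \<Rightarrow> 'a set \<Rightarrow> bool" where
  "is_line_segment X s \<longleftrightarrow> s \<subseteq> topspace X \<and>
     subtopology X s homeomorphic_space top_of_set {0..1::real}"


section \<open>Ribbon graphs\<close>

record 'a ribbon_graph =
  surf :: "'a topology"
  verts :: "'a set set"
  edges :: "'a set set"

text \<open>Pairwise disjoint compact segments, finite in number, are the connected components of their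
  union. So the segments in which vertices and edges meet are the components of the intersection of
  the union of the vertices with the union of the edges.\<close>

definition segments :: "('a, 'm) ribbon_graph_scheme \<Rightarrow> 'a set set" where
  "segments G = connected_components_of (subtopology (surf G) (\<Union>(verts G) \<inter> \<Union>(edges G)))"

definition is_ribbon_graph :: "('a, 'm) ribbon_graph_scheme \<Rightarrow> bool" where
  "is_ribbon_graph G \<longleftrightarrow>
     surface_with_boundary (surf G) \<and>
     finite (verts G) \<and> finite (edges G) \<and>
     topspace (surf G) = \<Union>(verts G) \<union> \<Union>(edges G) \<and>
     (\<forall>d \<in> verts G \<union> edges G. is_closed_disc (surf G) d) \<and>
     disjoint (verts G) \<and> disjoint (edges G) \<and>
     (\<forall>s \<in> segments G. is_line_segment (surf G) s \<and>
        (\<exists>!v. v \<in> verts G \<and> s \<subseteq> disc_boundary (surf G) v) \<and>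
        (\<exists>!e. e \<in> edges G \<and> s \<subseteq> disc_boundary (surf G) e)) \<and>
     (\<forall>e \<in> edges G. card {s \<in> segments G. s \<subseteq> e} = 2)"

text \<open>The boundary components of the ribbon subgraph \<open>(V, A)\<close>, as subsets of the surface.\<close>

definition boundary_components :: "('a, 'm) ribbon_graph_scheme \<Rightarrow> 'a set set \<Rightarrow> 'a set set" where
  "boundary_components G A =
     (let X = subtopology (surf G) (\<Union>(verts G) \<union> \<Union>A)
      in connected_components_of (subtopology X (surface_boundary X)))"

abbreviation faces :: "('a, 'm) ribbon_graph_scheme \<Rightarrow> 'a set set" where
  "faces G \<equiv> boundary_components G (edges G)"


section \<open>Coloured ribbon graphs and their duals\<close>

record 'a coloured_ribbon_graph = "'a ribbon_graph" +
  vertex_classes :: "'a set set set"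
  boundary_classes :: "'a set set set"

definition is_coloured_ribbon_graph :: "('a, 'm) coloured_ribbon_graph_scheme \<Rightarrow> bool" where
  "is_coloured_ribbon_graph G \<longleftrightarrow>
     is_ribbon_graph G \<and>
     partition_on (verts G) (vertex_classes G) \<and>
     partition_on (faces G) (boundary_classes G)"

text \<open>\<open>\<Sigma>\<close> is obtained from the surface of \<open>G\<close>, embedded by \<open>i\<close>, by capping off each boundary
  component \<open>f\<close> with a disc \<open>D f\<close>. As \<open>\<Sigma>\<close> is Hausdorff and a finite union of compact pieces, it
  carries the quotient topology of the gluing.\<close>

definition capping_off ::
  "('a, 'm) ribbon_graph_scheme \<Rightarrow> 'b topology \<Rightarrow> ('a \<Rightarrow> 'b) \<Rightarrow> ('a set \<Rightarrow> 'b set) \<Rightarrow> bool" where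
  "capping_off G \<Sigma> i D \<longleftrightarrow>
     Hausdorff_space \<Sigma> \<and>
     embedding_map (surf G) \<Sigma> i \<and>
     topspace \<Sigma> = i ` topspace (surf G) \<union> (\<Union>f\<in>faces G. D f) \<and>
     (\<forall>f\<in>faces G. is_closed_disc \<Sigma> (D f) \<and>
        disc_boundary \<Sigma> (D f) = i ` f \<and> D f \<inter> i ` topspace (surf G) = i ` f) \<and>
     (\<forall>f\<in>faces G. \<forall>g\<in>faces G. f \<noteq> g \<longrightarrow> D f \<inter> D g = {})"

text \<open>The geometric dual is determined only up to homeomorphism, so it is given as a relation:
  \<open>H\<close> is a dual of \<open>G\<close>. The boundary component of the dual corresponding to the vertex \<open>v\<close> of \<open>G\<close>
  is (the image of) the boundary circle of the disc \<open>v\<close>.\<close>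

definition is_geometric_dual_via ::
  "('a, 'm) ribbon_graph_scheme \<Rightarrow> ('b, 'n) ribbon_graph_scheme \<Rightarrow>
   'b topology \<Rightarrow> ('a \<Rightarrow> 'b) \<Rightarrow> ('a set \<Rightarrow> 'b set) \<Rightarrow> bool" where
  "is_geometric_dual_via G H \<Sigma> i D \<longleftrightarrow>
     capping_off G \<Sigma> i D \<and>
     verts H = D ` faces G \<and>
     edges H = (`) i ` edges G \<and>
     surf H = subtopology \<Sigma> (\<Union>(verts H) \<union> \<Union>(edges H))"

definition is_dual ::
  "('a, 'm) coloured_ribbon_graph_scheme \<Rightarrow> ('b, 'n) coloured_ribbon_graph_scheme \<Rightarrow> bool" where
  "is_dual G H \<longleftrightarrow>
     (\<exists>\<Sigma> i D. is_geometric_dual_via G H \<Sigma> i D \<and>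
        vertex_classes H = (\<lambda>C. D ` C) ` boundary_classes G \<and>
        boundary_classes H = (\<lambda>C. (\<lambda>v. i ` disc_boundary (surf G) v) ` C) ` vertex_classes G)"


section \<open>The rank parameters\<close>

text \<open>A multigraph is given by its vertex set \<open>N\<close> and the function \<open>ends\<close> that maps each edge to
  the set of its (one or two) end vertices.\<close>

definition connection :: "'n set \<Rightarrow> ('e \<Rightarrow> 'n set) \<Rightarrow> 'e set \<Rightarrow> ('n \<times> 'n) set" where
  "connection N ends A =
     {(x, y). x \<in> N \<and> y \<in> N \<and> (x, y) \<in> {(u, u'). \<exists>e\<in>A. u \<in> ends e \<and> u' \<in> ends e}\<^sup>*}"

definition graph_rank :: "'n set \<Rightarrow> ('e \<Rightarrow> 'n set) \<Rightarrow> 'e set \<Rightarrow> rat" where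
  "graph_rank N ends A = of_nat (card N) - of_nat (card (N // connection N ends A))"

text \<open>The classes joined by the edge \<open>e\<close>: those with a member that meets \<open>e\<close>.\<close>

definition classes_at :: "'a set set set \<Rightarrow> 'a set \<Rightarrow> 'a set set set" where
  "classes_at P e = {C \<in> P. \<exists>c\<in>C. c \<inter> e \<noteq> {}}"

definition vertex_rank :: "('a, 'm) coloured_ribbon_graph_scheme \<Rightarrow> 'a set set \<Rightarrow> rat" where
  "vertex_rank G A = graph_rank (vertex_classes G) (classes_at (vertex_classes G)) A"

definition boundary_rank :: "('a, 'm) coloured_ribbon_graph_scheme \<Rightarrow> 'a set set \<Rightarrow> rat" where
  "boundary_rank G A = graph_rank (boundary_classes G) (classes_at (boundary_classes G)) A"

definition rho :: "('a, 'm) ribbon_graph_scheme \<Rightarrow> 'a set set \<Rightarrow> rat" where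
  "rho G A = (of_nat (card A) + of_nat (card (verts G)) - of_nat (card (boundary_components G A))) / 2"

definition r1 :: "('a, 'm) coloured_ribbon_graph_scheme \<Rightarrow> 'a set set \<Rightarrow> rat" where
  "r1 G A = vertex_rank G A"

definition r2 :: "('a, 'm) coloured_ribbon_graph_scheme \<Rightarrow> 'a set set \<Rightarrow> rat" where
  "r2 G A = rho G A - vertex_rank G A"

definition r3 :: "('a, 'm) coloured_ribbon_graph_scheme \<Rightarrow> 'a set set \<Rightarrow> rat" where
  "r3 G A = boundary_rank G (edges G) - boundary_rank G (edges G - A)"

definition r4 :: "('a, 'm) coloured_ribbon_graph_scheme \<Rightarrow> 'a set set \<Rightarrow> rat" where
  "r4 G A = of_nat (card A) + boundary_rank G (edges G - A) - boundary_rank G (edges G) - rho G A"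


section \<open>The Tutte polynomial\<close>

text \<open>For non-orientable ribbon graphs \<open>rho\<close>, and hence the exponents, can be half-integers, so
  polynomials are formal integer combinations of monomials with rational exponents in
  indeterminates of type \<open>'v\<close>.\<close>

type_synonym 'v rpoly = "('v \<Rightarrow>\<^sub>0 rat) \<Rightarrow>\<^sub>0 int"

definition var_pow :: "'v \<Rightarrow> rat \<Rightarrow> 'v rpoly" where
  "var_pow v q = Poly_Mapping.single (Poly_Mapping.single v q) 1"

definition T_ps :: "('a, 'm) coloured_ribbon_graph_scheme \<Rightarrow> 'v \<Rightarrow> 'v \<Rightarrow> 'v \<Rightarrow> 'v \<Rightarrow> 'v rpoly" where
  "T_ps G w x y z =
     (\<Sum>A\<in>Pow (edges G).
        var_pow w (r1 G (edges G) - r1 G A) * var_pow x (r2 G (edges G) - r2 G A) *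
        var_pow y (r3 G A) * var_pow z (r4 G A))"

end

theory Submission
  imports Defs
begin

text \<open>
  Complementing edge sets, \<open>A \<mapsto> i ` (E - A)\<close>, matches the summands of the two polynomials. The
  vertex ranks and boundary ranks of \<open>G\<close> and its dual are exchanged because the two multigraphs on
  colour classes are isomorphic; what remains is to compare \<open>rho\<close>, i.e. to show that the ribbon
  subgraph \<open>(V, A)\<close> of \<open>G\<close> has as many boundary components as the ribbon subgraph of the dual with
  edges \<open>E - A\<close>. The capped surface is covered by the discs of these two subgraphs, and discs from
  different subgraphs meet only in their boundaries. As the capped surface is locally homeomorphic
  to the plane, invariance of domain shows that the manifold boundary of either subgraph is exactly
  the intersection of the two.
\<close>

section \<open>Open embeddings and planar points\<close>

text \<open>A capping is given only as a Hausdorff space that contains an embedded copy of the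
  surface and the cap discs; that it is locally planar has to be proved. Away from the seams, the
  circles along which caps meet the surface, a neighbourhood lies in a single piece and planarity is
  inherited. At a seam, a half-plane chart of the surface and one of the cap must be glued into one
  planar chart. The surface has such charts by definition; a disc gets them from a Cayley transform.
  To isolate one seam, all other caps are removed, and this leaves an open set only because there
  are finitely many of them. Finiteness of the set of boundary components comes from compactness of
  the surface. In the numerical part, equality of the numbers of boundary components gives
  \<open>rho\<close> of all dual edges minus \<open>rho\<close> of the dual edges of E - A as |A| -
  \<open>rho\<close> of A. The edgeless subgraph enters here: its boundary components are the vertex
  circles, so the full dual has |V| boundary components.\<close>

definition open_embedding :: "'a topology \<Rightarrow> 'b topology \<Rightarrow> ('a \<Rightarrow> 'b) \<Rightarrow> bool" where
  "open_embedding X Y f \<longleftrightarrow> continuous_map X Y f \<and> open_map X Y f \<and> inj_on f (topspace X)"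

lemma open_embeddingD:
  assumes "open_embedding X Y f"
  shows "continuous_map X Y f" "open_map X Y f" "inj_on f (topspace X)"
    "openin Y (f ` topspace X)"
  using assms by (auto simp: open_embedding_def open_map_def)

lemma open_embedding_compose:
  assumes "open_embedding X Y f" "open_embedding Y Z g"
  shows "open_embedding X Z (g \<circ> f)"
proof -
  have "f ` topspace X \<subseteq> topspace Y"
    using assms(1) by (simp add: continuous_map_image_subset_topspace open_embedding_def)
  then show ?thesis
    using assms unfolding open_embedding_def
    by (meson comp_inj_on continuous_map_compose inj_on_subset open_map_compose)
qed

lemma open_embedding_subtopology:
  assumes "open_embedding X Y f" "openin X U"
  shows "open_embedding (subtopology X U) Y f"
  using assms unfolding open_embedding_def
  by (auto intro: continuous_map_from_subtopology open_map_from_subtopology inj_on_subset)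

lemma homeomorphic_map_imp_open_embedding:
  "homeomorphic_map X Y f \<Longrightarrow> open_embedding X Y f"
  by (simp add: homeomorphic_eq_everything_map open_embedding_def)

lemma open_embedding_inclusion:
  assumes "openin X U"
  shows "open_embedding (subtopology X U) X (\<lambda>x. x)"
  using assms open_map_inclusion[OF assms]
  by (auto simp: open_embedding_def continuous_map_from_subtopology id_def)

lemma homeomorphic_map_into_open_imp_open_embedding:
  assumes "homeomorphic_map X (subtopology Y U) f" "openin Y U"
  shows "open_embedding X Y f"
  using open_embedding_compose[OF homeomorphic_map_imp_open_embedding[OF assms(1)]
      open_embedding_inclusion[OF assms(2)]]
  by (simp add: comp_def)

lemma open_embedding_imp_homeomorphic_map:
  assumes "open_embedding X Y f"
  shows "homeomorphic_map X (subtopology Y (f ` topspace X)) f"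
  using assms injective_open_imp_embedding_map[of X Y f]
  by (simp add: open_embedding_def embedding_map_def)

text \<open>On its open image \<open>h\<close> has a continuous inverse, so a chart of
  \<open>Y\<close> that stays in this image pulls back to \<open>X\<close>. This is the harder
  direction in the invariance of planar and half-planar points under open embeddings.\<close>

lemma open_embedding_lift:
  assumes h: "open_embedding X Y h" and g: "open_embedding Z Y g"
    and sub: "g ` topspace Z \<subseteq> h ` topspace X"
  shows "open_embedding Z X (inv_into (topspace X) h \<circ> g)"
proof -
  let ?U = "h ` topspace X"
  obtain k where k: "homeomorphic_maps X (subtopology Y ?U) h k"
    using open_embedding_imp_homeomorphic_map[OF h] by (auto simp: homeomorphic_map_maps)
  have top: "topspace (subtopology Y ?U) = ?U"
    using open_embeddingD(4)[OF h] by (simp add: openin_subset inf_absorb2)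
  have keq: "k y = inv_into (topspace X) h y" if y: "y \<in> ?U" for y
    using k y open_embeddingD(3)[OF h] by (auto simp: homeomorphic_maps_def)
  have "homeomorphic_map (subtopology Y ?U) X k"
    using k homeomorphic_maps_map homeomorphic_maps_sym by blast
  then have "homeomorphic_map (subtopology Y ?U) X (inv_into (topspace X) h)"
    by (rule homeomorphic_map_eq) (use keq top in auto)
  moreover have "open_embedding Z (subtopology Y ?U) g"
    using g sub open_map_into_subtopology unfolding open_embedding_def
    by (metis continuous_map_into_subtopology image_subset_iff_funcset)
  ultimately show ?thesis
    using open_embedding_compose homeomorphic_map_imp_open_embedding by blast
qed

lemma homeomorphism_imp_open_embedding:
  assumes "homeomorphism S T f g" "openin (top_of_set Z) T"
  shows "open_embedding (top_of_set S) (top_of_set Z) f"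
proof -
  have "homeomorphic_maps (top_of_set S) (top_of_set T) f g"
    using assms(1)  by (auto simp: homeomorphic_maps_def homeomorphism_def)
  moreover have "subtopology (top_of_set Z) T = top_of_set T"
    using assms(2) by (metis inf_absorb2 openin_imp_subset subtopology_subtopology)
  ultimately have "homeomorphic_map (top_of_set S) (subtopology (top_of_set Z) T) f"
    by (metis homeomorphic_maps_map)
  then show ?thesis
    using assms(2) homeomorphic_map_into_open_imp_open_embedding by blast
qed

section \<open>Locality of planar points and invariance of domain\<close>

text \<open>Any open subset of the plane may serve as chart domain, so restrictions of charts to
  open preimages are again charts without rescaling to the whole plane.\<close>

definition planar_at :: "'a topology \<Rightarrow> 'a \<Rightarrow> bool" where
  "planar_at X p \<longleftrightarrow>
     (\<exists>S f. open (S :: complex set) \<and> open_embedding (top_of_set S) X f \<and> p \<in> f ` S)"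

text \<open>A chart domain can be shrunk to a ball around the point in question, and an open ball is
  homeomorphic to the whole plane.\<close>

lemma planar_at_iff_chart:
  "planar_at X p \<longleftrightarrow> (\<exists>U. openin X U \<and> p \<in> U \<and>
        subtopology X U homeomorphic_space (euclidean :: complex topology))"
proof
  assume "planar_at X p"
  then obtain S f s where S: "open (S :: complex set)" and f: "open_embedding (top_of_set S) X f"
    and s: "s \<in> S" "p = f s"
    unfolding planar_at_def by blast
  obtain r where r: "r > 0" "ball s r \<subseteq> S"
    using S s openE by blast
  have b: "openin (top_of_set S) (ball s r)"
    using r by (simp add: openin_open_eq S)
  have f': "open_embedding (top_of_set (ball s r)) X f"
    using open_embedding_subtopology[OF f b] r by (simp add: subtopology_subtopology inf_absorb2)
  have "subtopology X (f ` ball s r) homeomorphic_space top_of_set (ball s r)"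
    using open_embedding_imp_homeomorphic_map[OF f'] homeomorphic_map_imp_homeomorphic_space
      homeomorphic_space_sym by fastforce
  also have "top_of_set (ball s r) homeomorphic_space (euclidean :: complex topology)"
  proof -
    obtain h k where "homeomorphism (ball s r) (UNIV :: complex set) h k"
      using homeomorphic_ball_UNIV[OF r(1), of s] by (auto simp: homeomorphic_def)
    then have "homeomorphic_maps (top_of_set (ball s r)) euclidean h k"
      by (auto simp: homeomorphic_maps_def homeomorphism_def continuous_map_in_subtopology)
    then show ?thesis unfolding homeomorphic_space_def by blast
  qed
  finally show "\<exists>U. openin X U \<and> p \<in> U \<and>
        subtopology X U homeomorphic_space (euclidean :: complex topology)"
    using open_embeddingD(4)[OF f'] r s by fastforce
next
  assume "\<exists>U. openin X U \<and> p \<in> U \<and>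
        subtopology X U homeomorphic_space (euclidean :: complex topology)"
  then obtain U f where U: "openin X U" "p \<in> U"
    and f: "homeomorphic_map (euclidean :: complex topology) (subtopology X U) f"
    by (metis homeomorphic_space homeomorphic_space_sym)
  have "open_embedding (top_of_set (UNIV :: complex set)) X f"
    using homeomorphic_map_into_open_imp_open_embedding[OF f U(1)] by simp
  moreover have "p \<in> range f"
    using homeomorphic_imp_surjective_map[OF f] U openin_subset by fastforce
  ultimately show "planar_at X p"
    unfolding planar_at_def by blast
qed

lemma surface_boundary_eq: "surface_boundary X = {p \<in> topspace X. \<not> planar_at X p}"
  by (simp add: surface_boundary_def planar_at_iff_chart)

lemma open_chart_preimage:
  assumes f: "continuous_map (top_of_set S) X f" and S: "open (S :: complex set)"
    and U: "openin X U"
  shows "open {z \<in> S. f z \<in> U}"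
proof -
  have "openin (top_of_set S) {z \<in> topspace (top_of_set S). f z \<in> U}"
    by (rule openin_continuous_map_preimage[OF f U])
  then show ?thesis
    using S openin_open_eq by fastforce
qed

lemma planar_at_open_embedding:
  assumes h: "open_embedding X Y h" and p: "p \<in> topspace X"
  shows "planar_at Y (h p) \<longleftrightarrow> planar_at X p"
proof
  assume "planar_at X p"
  then obtain S f where "open (S :: complex set)" "open_embedding (top_of_set S) X f" "p \<in> f ` S"
    unfolding planar_at_def by blast
  moreover from this h have "open_embedding (top_of_set S) Y (h \<circ> f)"
    using open_embedding_compose by blast
  ultimately show "planar_at Y (h p)"
    unfolding planar_at_def by (metis image_comp imageI)
next
  assume "planar_at Y (h p)"
  then obtain S f s where S: "open (S :: complex set)" and f: "open_embedding (top_of_set S) Y f"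
    and s: "s \<in> S" "h p = f s"
    unfolding planar_at_def by blast
  define T where "T = {z \<in> S. f z \<in> h ` topspace X}"
  have T: "open T"
    unfolding T_def
    by (rule open_chart_preimage[OF open_embeddingD(1)[OF f] S open_embeddingD(4)[OF h]])
  have f': "open_embedding (top_of_set T) Y f"
  proof -
    have "T \<subseteq> S" by (auto simp: T_def)
    then show ?thesis
      using open_embedding_subtopology[OF f, of T] T S
      by (simp add: openin_open_eq subtopology_subtopology inf_absorb2)
  qed
  let ?g = "inv_into (topspace X) h \<circ> f"
  have "open_embedding (top_of_set T) X ?g"
    by (rule open_embedding_lift[OF h f']) (auto simp: T_def)
  moreover have "s \<in> T"
    using s p by (auto simp: T_def image_iff intro!: bexI[of _ p])
  moreover have "?g s = p"
    using s p open_embeddingD(3)[OF h] by (metis comp_apply inv_into_f_f)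
  ultimately show "planar_at X p"
    unfolding planar_at_def using T by blast
qed

lemma surface_boundary_open_embedding:
  assumes "open_embedding X Y h" "p \<in> topspace X"
  shows "h p \<in> surface_boundary Y \<longleftrightarrow> p \<in> surface_boundary X"
  using assms planar_at_open_embedding[OF assms]
  by (auto simp: surface_boundary_eq open_embedding_def continuous_map_def)

lemma surface_boundary_homeomorphic_map:
  assumes "homeomorphic_map X Y h"
  shows "surface_boundary Y = h ` surface_boundary X"
proof -
  have e: "open_embedding X Y h" and i: "h ` topspace X = topspace Y"
    using assms by (auto simp: homeomorphic_map_imp_open_embedding homeomorphic_imp_surjective_map)
  show ?thesis
  proof
    show "surface_boundary Y \<subseteq> h ` surface_boundary X"
    proof
      fix y assume y: "y \<in> surface_boundary Y"
      then obtain x where "x \<in> topspace X" "y = h x"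
        using i by (auto simp: surface_boundary_eq)
      then show "y \<in> h ` surface_boundary X"
        using y surface_boundary_open_embedding[OF e] by blast
    qed
    show "h ` surface_boundary X \<subseteq> surface_boundary Y"
      using surface_boundary_open_embedding[OF e] by (force simp: surface_boundary_eq)
  qed
qed

lemma surface_boundary_subset: "surface_boundary X \<subseteq> topspace X"
  by (auto simp: surface_boundary_def)

lemma surface_boundary_open_subtopology:
  assumes "openin X U"
  shows "surface_boundary (subtopology X U) = U \<inter> surface_boundary X"
  using surface_boundary_open_embedding[OF open_embedding_inclusion[OF assms]] openin_subset[OF assms]
    surface_boundary_subset[of "subtopology X U"]
  by (auto)

lemma openin_planar_points: "openin X {p. planar_at X p}"
proof (subst openin_subopen, clarify)
  fix p assume "planar_at X p"
  then obtain S f where S: "open (S :: complex set)" and f: "open_embedding (top_of_set S) X f"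
    and p: "p \<in> f ` S"
    unfolding planar_at_def by blast
  have "openin X (f ` S)"
    using open_embeddingD(4)[OF f] by simp
  moreover have "f ` S \<subseteq> {p. planar_at X p}"
    unfolding planar_at_def using S f by blast
  ultimately show "\<exists>T. openin X T \<and> p \<in> T \<and> T \<subseteq> {p. planar_at X p}"
    using p by blast
qed

lemma closedin_surface_boundary: "closedin X (surface_boundary X)"
proof -
  have "surface_boundary X = topspace X - {p. planar_at X p}"
    by (auto simp: surface_boundary_eq)
  then show ?thesis
    using openin_planar_points[of X] by (metis closedin_diff closedin_topspace)
qed

text \<open>Seen through a chart of \<open>Y\<close>, a chart of the subspace \<open>K\<close>
  becomes a continuous injection between plane sets with open domain. By invariance of domain its
  image is open, so \<open>K\<close> contains a neighbourhood of \<open>p\<close> in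
  \<open>Y\<close>.\<close>

lemma planar_at_subtopology_imp_interior:
  assumes Y: "planar_at Y p" and K: "planar_at (subtopology Y K) p"
  shows "\<exists>U. openin Y U \<and> p \<in> U \<and> U \<subseteq> K"
proof -
  obtain S f s where S: "open (S :: complex set)" and f: "open_embedding (top_of_set S) Y f"
    and s: "s \<in> S" "p = f s"
    using Y unfolding planar_at_def by blast
  obtain T g t where T: "open (T :: complex set)"
    and g: "open_embedding (top_of_set T) (subtopology Y K) g" and t: "t \<in> T" "p = g t"
    using K unfolding planar_at_def by blast
  have gc: "continuous_map (top_of_set T) Y g"
    using g by (auto simp: open_embedding_def continuous_map_in_subtopology)
  have gK: "g ` T \<subseteq> K"
    using g by (auto simp: open_embedding_def continuous_map_in_subtopology)
  have fS: "openin Y (f ` S)"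
    using open_embeddingD(4)[OF f] by simp
  \<comment> \<open>The part of the domain of \<open>g\<close> whose image lies in the range of the
    chart \<open>f\<close>; only there is the transition map from \<open>g\<close> to
    \<open>f\<close> defined.\<close>
  define W where "W = {z \<in> T. g z \<in> f ` S}"
  have W: "open W"
    unfolding W_def by (rule open_chart_preimage[OF gc T fS])
  have "homeomorphic_map (top_of_set S) (subtopology Y (f ` S)) f"
    using open_embedding_imp_homeomorphic_map[OF f] by simp
  then obtain k where k: "homeomorphic_maps (top_of_set S) (subtopology Y (f ` S)) f k"
    by (auto simp: homeomorphic_map_maps)
  have top: "topspace (subtopology Y (f ` S)) = f ` S"
    using fS by (simp add: openin_subset inf_absorb2)
  have gW: "continuous_map (top_of_set W) (subtopology Y (f ` S)) g"
  proof (rule continuous_map_into_subtopology)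
    have "continuous_map (subtopology (top_of_set T) W) Y g"
      using gc by (rule continuous_map_from_subtopology)
    moreover have "subtopology (top_of_set T) W = top_of_set W"
      by (simp add: W_def subtopology_subtopology inf_absorb2 Collect_restrict)
    ultimately show "continuous_map (top_of_set W) Y g" by simp
  qed (auto simp: W_def)
  \<comment> \<open>The map \<open>k \<circ> g\<close> is this transition map, with \<open>k\<close>
    the inverse of \<open>f\<close> on its image.\<close>
  have "continuous_map (top_of_set W) (top_of_set S) (k \<circ> g)"
    using gW k unfolding homeomorphic_maps_def by (metis continuous_map_compose)
  then have kg: "continuous_on W (k \<circ> g)" "(k \<circ> g) ` W \<subseteq> S"
    by auto
  have fk: "f (k (g z)) = g z" if "z \<in> W" for z
    using k that top by (auto simp: homeomorphic_maps_def W_def)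
  have "inj_on (k \<circ> g) W"
  proof (rule inj_onI)
    fix a b assume "a \<in> W" "b \<in> W" "(k \<circ> g) a = (k \<circ> g) b"
    then have "g a = g b" using fk by (metis comp_apply)
    then show "a = b"
      using \<open>a \<in> W\<close> \<open>b \<in> W\<close> open_embeddingD(3)[OF g] by (auto simp: W_def inj_on_def)
  qed
  then have "open ((k \<circ> g) ` W)"
    using invariance_of_domain kg W by blast
  then have "openin (top_of_set S) ((k \<circ> g) ` W)"
    using kg S openin_open_eq by blast
  then have "openin Y (f ` (k \<circ> g) ` W)"
    using open_embeddingD(2)[OF f] by (simp add: open_map_def)
  moreover have "f ` (k \<circ> g) ` W = g ` W"
    using fk by (force simp: image_iff)
  moreover have "p \<in> g ` W"
    using s t by (intro image_eqI[of _ _ t]) (auto simp: W_def)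
  moreover have "g ` W \<subseteq> K"
    using gK by (auto simp: W_def)
  ultimately show ?thesis by metis
qed

lemma open_embedding_open_piece:
  assumes "openin Y U" "U \<subseteq> K"
  shows "open_embedding (subtopology Y U) (subtopology Y K) (\<lambda>x. x)"
proof -
  have "openin (subtopology Y K) U"
    using assms by (metis inf.absorb1 openin_subtopology_Int)
  from open_embedding_inclusion[OF this] show ?thesis
    using assms by (simp add: subtopology_subtopology inf_absorb2)
qed

lemma planar_at_open_piece:
  assumes "openin Y U" "U \<subseteq> K" "p \<in> U"
  shows "planar_at (subtopology Y K) p \<longleftrightarrow> planar_at Y p"
  using planar_at_open_embedding[OF open_embedding_open_piece[OF assms(1,2)], of p]
    planar_at_open_embedding[OF open_embedding_inclusion[OF assms(1)], of p]
    assms openin_subset[OF assms(1)] by auto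

text \<open>Off \<open>L\<close>, the complement of \<open>L\<close> is an open neighbourhood inside
  \<open>K\<close>, so planarity is inherited from \<open>Y\<close>. A common point of
  \<open>K\<close> and \<open>L\<close> is a limit of points outside \<open>K\<close>, so
  \<open>K\<close> contains no neighbourhood of it and it cannot be planar in \<open>K\<close>. The
  density hypothesis excludes parts of \<open>L\<close> buried inside \<open>K\<close>.\<close>

lemma surface_boundary_of_piece:
  assumes planar: "\<And>p. p \<in> topspace Y \<Longrightarrow> planar_at Y p"
    and K: "closedin Y K" "closedin Y L" "K \<union> L = topspace Y"
    and dense: "K \<inter> L \<subseteq> Y closure_of (L - K)"
  shows "surface_boundary (subtopology Y K) = K \<inter> L"
proof -
  have KY: "K \<subseteq> topspace Y" using K closedin_subset by blast
  have "planar_at (subtopology Y K) p \<longleftrightarrow> p \<notin> L" if p: "p \<in> K" for p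
  proof
    assume pl: "planar_at (subtopology Y K) p"
    have "planar_at Y p" using planar p KY by blast
    from planar_at_subtopology_imp_interior[OF this pl]
    obtain U where U: "openin Y U" "p \<in> U" "U \<subseteq> K" by blast
    show "p \<notin> L"
    proof
      assume "p \<in> L"
      then have "p \<in> Y closure_of (L - K)" using dense p by blast
      then show False using U unfolding in_closure_of by blast
    qed
  next
    assume "p \<notin> L"
    then show "planar_at (subtopology Y K) p"
      using planar_at_open_piece[of Y "topspace Y - L" K p] planar[of p] K p KY by blast
  qed
  then show ?thesis
    using KY by (auto simp: surface_boundary_eq)
qed

section \<open>Half-plane charts\<close>

abbreviation half_plane :: "complex set" where
  "half_plane \<equiv> {z. 0 \<le> Im z}"

text \<open>A box rather than a half disc, so that the gluing can treat the coordinate along the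
  boundary and the one across it separately.\<close>

definition half_box :: "complex set" where
  "half_box = {z. \<bar>Re z\<bar> < 1 \<and> 0 \<le> Im z \<and> Im z < 1}"

text \<open>Points with positive imaginary part have plane neighbourhoods in \<open>W\<close>. If a
  point on the real axis were planar, invariance of domain would put a full plane ball around it
  into \<open>W\<close>, although \<open>W\<close> has no points below the axis.\<close>

lemma half_plane_chart_boundary:
  assumes W: "openin (top_of_set half_plane) W" and f: "open_embedding (top_of_set W) X f"
    and z: "z \<in> W"
  shows "f z \<in> surface_boundary X \<longleftrightarrow> Im z = 0"
proof -
  have W0: "0 \<le> Im z" and Wh: "W \<subseteq> half_plane" using W z openin_imp_subset by blast+
  obtain T where T: "open T" "W = half_plane \<inter> T" using W by (auto simp: openin_open)
  have "planar_at (top_of_set W) z \<longleftrightarrow> Im z \<noteq> 0"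
  proof
    assume pl: "planar_at (top_of_set W) z"
    have "open_embedding (top_of_set UNIV) euclidean (\<lambda>x :: complex. x)"
      using open_embedding_inclusion[of euclidean UNIV] by simp
    then have "planar_at euclidean z" unfolding planar_at_def by blast
    from planar_at_subtopology_imp_interior[OF this pl]
    obtain U where U: "open U" "z \<in> U" "U \<subseteq> W" by auto
    then obtain e where e: "e > 0" "ball z e \<subseteq> W" by (metis openE subset_trans)
    show "Im z \<noteq> 0"
    proof
      assume 0: "Im z = 0"
      \<comment> \<open>A point of the ball strictly below the real axis, hence outside
        \<open>W\<close>.\<close>
      have "z - \<i> * complex_of_real (e/2) \<in> ball z e"
        using e by (simp add: dist_norm norm_mult)
      then have "0 \<le> Im (z - \<i> * complex_of_real (e/2))" using e Wh by blast
      then show False using 0 e by simp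
    qed
  next
    assume "Im z \<noteq> 0"
    let ?S = "T \<inter> {w. 0 < Im w}"
    have S: "open ?S" using T by (intro open_Int open_halfspace_Im_gt) auto
    have SW: "?S \<subseteq> W" using T by auto
    then have "openin (top_of_set W) ?S" using S openin_open_eq by (simp add: open_subset)
    then have "open_embedding (top_of_set ?S) (top_of_set W) (\<lambda>x. x)"
      using open_embedding_inclusion SW by (metis inf.absorb2 subtopology_subtopology)
    moreover have "z \<in> ?S" using \<open>Im z \<noteq> 0\<close> W0 z T by auto
    ultimately show "planar_at (top_of_set W) z" unfolding planar_at_def using S by blast
  qed
  then have "z \<in> surface_boundary (top_of_set W) \<longleftrightarrow> Im z = 0"
    using z by (auto simp: surface_boundary_eq)
  then show ?thesis using surface_boundary_open_embedding[OF f] z by auto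
qed

text \<open>The local condition of \<open>surface_with_boundary\<close> at a single point, isolated
  so that it can be used for cap discs and for open parts of the surface too.\<close>

definition half_planar_at :: "'a topology \<Rightarrow> 'a \<Rightarrow> bool" where
  "half_planar_at X p \<longleftrightarrow>
     (\<exists>W f. openin (top_of_set half_plane) W \<and> open_embedding (top_of_set W) X f \<and> p \<in> f ` W)"

lemma half_planar_at_open_embedding:
  assumes "half_planar_at X p" "open_embedding X Y h"
  shows "half_planar_at Y (h p)"
proof -
  obtain W f where "openin (top_of_set half_plane) W" "open_embedding (top_of_set W) X f" "p \<in> f ` W"
    using assms(1) unfolding half_planar_at_def by blast
  moreover from this assms(2) have "open_embedding (top_of_set W) Y (h \<circ> f)"
    using open_embedding_compose by blast
  ultimately show ?thesis
    unfolding half_planar_at_def by (metis image_comp imageI)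
qed

lemma half_planar_at_open_embedding_iff:
  assumes h: "open_embedding X Y h" and p: "p \<in> topspace X"
  shows "half_planar_at Y (h p) \<longleftrightarrow> half_planar_at X p"
proof
  assume "half_planar_at Y (h p)"
  then obtain W f s where W: "openin (top_of_set half_plane) W" and f: "open_embedding (top_of_set W) Y f"
    and s: "s \<in> W" "h p = f s"
    unfolding half_planar_at_def by blast
  define T where "T = {z \<in> W. f z \<in> h ` topspace X}"
  have TW: "T \<subseteq> W" by (auto simp: T_def)
  have T: "openin (top_of_set W) T"
    using openin_continuous_map_preimage[OF open_embeddingD(1)[OF f] open_embeddingD(4)[OF h]]
    by (simp add: T_def)
  have f': "open_embedding (top_of_set T) Y f"
    using open_embedding_subtopology[OF f T] TW by (simp add: subtopology_subtopology inf_absorb2)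
  let ?g = "inv_into (topspace X) h \<circ> f"
  have "open_embedding (top_of_set T) X ?g"
    by (rule open_embedding_lift[OF h f']) (auto simp: T_def)
  moreover have "s \<in> T"
    using s p by (auto simp: T_def image_iff intro!: bexI[of _ p])
  moreover have "?g s = p"
    using s p open_embeddingD(3)[OF h] by (metis comp_apply inv_into_f_f)
  moreover have "openin (top_of_set half_plane) T"
    using T W openin_trans by blast
  ultimately show "half_planar_at X p"
    unfolding half_planar_at_def by blast
qed (rule half_planar_at_open_embedding[OF _ h])

lemma surface_with_boundary_half_planar:
  assumes "surface_with_boundary X" "p \<in> topspace X"
  shows "half_planar_at X p"
proof -
  obtain U W where U: "openin X U" "p \<in> U" and W: "openin (top_of_set half_plane) W"
    and "subtopology X U homeomorphic_space top_of_set W"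
    using assms unfolding surface_with_boundary_def by blast
  then obtain f where f: "homeomorphic_map (top_of_set W) (subtopology X U) f"
    by (metis homeomorphic_space homeomorphic_space_sym)
  have "p \<in> f ` W"
    using homeomorphic_imp_surjective_map[OF f] U openin_subset by fastforce
  then show ?thesis
    unfolding half_planar_at_def
    using W homeomorphic_map_into_open_imp_open_embedding[OF f U(1)] by blast
qed

text \<open>A chart at a boundary point takes its value there at a point \<open>z\<close> of the
  real axis; translating and scaling by real amounts preserves the half plane and its axis, and
  normalises the domain to \<open>half_box\<close> and \<open>z\<close> to \<open>0\<close>.\<close>

lemma half_box_chart:
  assumes "half_planar_at X p" "p \<in> surface_boundary X"
  obtains f where "open_embedding (top_of_set half_box) X f" "f 0 = p"
    "\<And>z. z \<in> half_box \<Longrightarrow> f z \<in> surface_boundary X \<longleftrightarrow> Im z = 0"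
proof -
  obtain W f z where W: "openin (top_of_set half_plane) W" and f: "open_embedding (top_of_set W) X f"
    and z: "z \<in> W" "p = f z"
    using assms(1) unfolding half_planar_at_def by blast
  have z0: "Im z = 0" using half_plane_chart_boundary[OF W f z(1)] assms(2) z by blast
  obtain T where T: "open T" "W = half_plane \<inter> T" using W by (auto simp: openin_open)
  then obtain e where e: "e > 0" "ball z e \<subseteq> T" using z by (meson IntD2 openE)
  \<comment> \<open>Half of \<open>e\<close>, because the modulus is at most the sum of the absolute
    values of the two coordinates, each below \<open>r\<close> on the box.\<close>
  define r where "r = e / 2"
  have r: "r > 0" using e by (simp add: r_def)
  define a where "a = (\<lambda>w. z + complex_of_real r * w)"
  define B where "B = {w. \<bar>Re (w - z)\<bar> < r \<and> 0 \<le> Im w \<and> Im w < r}"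
  have BW: "B \<subseteq> W"
  proof
    fix w assume w: "w \<in> B"
    have "cmod (w - z) \<le> \<bar>Re (w - z)\<bar> + \<bar>Im (w - z)\<bar>" by (rule cmod_le)
    also have "\<dots> < r + r" using w z0 by (intro add_strict_mono) (auto simp: B_def)
    finally have "w \<in> ball z e" by (simp add: r_def dist_norm norm_minus_commute)
    then show "w \<in> W" using T e w by (auto simp: B_def)
  qed
  have "B = W \<inter> {w. \<bar>Re (w - z)\<bar> < r \<and> Im w < r}"
    using BW T by (auto simp: B_def)
  moreover have "open {w. \<bar>Re (w - z)\<bar> < r \<and> Im w < r}"
    by (intro open_Collect_conj open_Collect_less continuous_intros)
  ultimately have BoW: "openin (top_of_set W) B" by (auto simp: openin_open)
  have hom: "homeomorphism half_box B a (\<lambda>w. (w - z) / complex_of_real r)"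
  proof (rule homeomorphismI)
    show "a ` half_box \<subseteq> B"
      using r z0 by (auto simp: half_box_def B_def a_def abs_mult)
    show "(\<lambda>w. (w - z) / complex_of_real r) ` B \<subseteq> half_box"
      using r z0 by (auto simp: half_box_def B_def field_simps)
  qed (use r in \<open>auto simp: a_def intro!: continuous_intros\<close>)
  have "open_embedding (top_of_set half_box) (top_of_set W) a"
    by (rule homeomorphism_imp_open_embedding[OF hom BoW])
  then have e: "open_embedding (top_of_set half_box) X (f \<circ> a)"
    using f open_embedding_compose by blast
  show thesis
  proof (rule that[OF e])
    show "(f \<circ> a) 0 = p" using z by (simp add: a_def)
    fix w assume w: "w \<in> half_box"
    then have "a w \<in> W" using hom BW by (auto simp: homeomorphism_def)
    moreover have "Im (a w) = 0 \<longleftrightarrow> Im w = 0" using z0 r by (simp add: a_def)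
    ultimately show "(f \<circ> a) w \<in> surface_boundary X \<longleftrightarrow> Im w = 0"
      using half_plane_chart_boundary[OF W f] by simp
  qed
qed

text \<open>The chart at a point \<open>q\<close> of the circle is the Cayley transform of the half plane that maps
  \<open>0\<close> to \<open>q\<close> and omits only \<open>- q\<close>.\<close>

lemma cball_half_planar_at_sphere:
  fixes q :: complex
  assumes q: "cmod q = 1"
  obtains f where "open_embedding (top_of_set half_plane) (top_of_set (cball 0 1)) f" "f 0 = q"
proof -
  define f where "f = (\<lambda>w. q * ((\<i> - w) / (\<i> + w)))"
  define g where "g = (\<lambda>z. \<i> * ((q - z) / (q + z)))"
  let ?T = "cball 0 1 - {- q}"
  have q0: "q \<noteq> 0" using q by auto
  have iw: "\<i> + w \<noteq> 0" if "0 \<le> Im w" for w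
  proof
    assume "\<i> + w = 0"
    then have "Im (\<i> + w) = 0" by simp
    then show False using that by simp
  qed
  have qz: "q + z \<noteq> 0" if "z \<in> ?T" for z
    using that by (auto simp: add_eq_0_iff)
  have hom: "homeomorphism half_plane ?T f g"
  proof (rule homeomorphismI)
    show "continuous_on half_plane f"
      unfolding f_def using iw by (intro continuous_intros) auto
    show "continuous_on ?T g"
      unfolding g_def using qz by (intro continuous_intros) auto
    show "f ` half_plane \<subseteq> ?T"
    proof clarify
      fix w assume w: "0 \<le> Im w"
      \<comment> \<open>A point of the upper half plane is at least as close to the imaginary unit
        as to its negative, so the quotient in \<open>f\<close> has modulus at most 1.\<close>
      have "(cmod (\<i> - w))\<^sup>2 \<le> (cmod (\<i> + w))\<^sup>2"
        using w unfolding cmod_power2 by (simp add: power2_eq_square algebra_simps)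
      then have "cmod (\<i> - w) \<le> cmod (\<i> + w)"
        using power2_le_imp_le norm_ge_zero by blast
      then have "cmod (f w) \<le> 1"
        using q iw[OF w] by (simp add: f_def norm_mult norm_divide divide_le_eq_1)
      moreover have "f w \<noteq> - q"
      proof
        assume "f w = - q"
        then have "(\<i> - w) / (\<i> + w) = - 1"
          using q0 by (metis f_def mult_cancel_left mult_minus1_right)
        then have "\<i> - w = - (\<i> + w)" using iw[OF w] by (simp add: field_simps)
        then show False by (simp add: complex_eq_iff)
      qed
      ultimately show "f w \<in> ?T" by simp
    qed
    show "g ` ?T \<subseteq> half_plane"
    proof clarify
      fix z assume z: "z \<in> cball 0 1" "z \<noteq> - q"
      have "Im (g z) = Re ((q - z) / (q + z))" unfolding g_def by (rule Im_i_times)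
      also have "\<dots> = Re ((q - z) * cnj (q + z)) / (cmod (q + z))\<^sup>2"
        by (subst complex_div_cnj) (simp only: Re_divide_of_real flip: of_real_power)
      \<comment> \<open>The two cross terms are negatives of each other's conjugates, so together
        they are purely imaginary.\<close>
      also have "Re ((q - z) * cnj (q + z)) = (cmod q)\<^sup>2 - (cmod z)\<^sup>2"
        unfolding cmod_power2 by (simp add: power2_eq_square algebra_simps)
      also have "\<dots> / (cmod (q + z))\<^sup>2 \<ge> 0"
        using z q by (intro divide_nonneg_nonneg) (auto simp: power_le_one)
      finally show "0 \<le> Im (g z)" .
    qed
    show "g (f w) = w" if "w \<in> half_plane" for w
    proof -
      have w: "\<i> + w \<noteq> 0" using that iw by auto
      have "q - f w = q * (1 - (\<i> - w) / (\<i> + w))" "q + f w = q * (1 + (\<i> - w) / (\<i> + w))"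
        by (simp_all only: f_def right_diff_distrib distrib_left mult_1_right)
      then have "g (f w) = \<i> * ((1 - (\<i> - w) / (\<i> + w)) / (1 + (\<i> - w) / (\<i> + w)))"
        using q0 by (simp only: g_def mult_divide_mult_cancel_left not_False_eq_True)
      also have "1 - (\<i> - w) / (\<i> + w) = 2 * w / (\<i> + w)"
        using w by (simp add: field_simps)
      also have "1 + (\<i> - w) / (\<i> + w) = 2 * \<i> / (\<i> + w)"
        using w by (simp add: field_simps)
      also have "\<i> * (2 * w / (\<i> + w) / (2 * \<i> / (\<i> + w))) = w" using w by simp
      finally show ?thesis .
    qed
    show "f (g z) = z" if "z \<in> ?T" for z
    proof -
      have z: "q + z \<noteq> 0" using that qz by auto
      have "f (g z) = q * ((\<i> * (1 - (q - z) / (q + z))) / (\<i> * (1 + (q - z) / (q + z))))"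
        unfolding f_def g_def by (simp add: algebra_simps)
      also have "\<dots> = q * ((1 - (q - z) / (q + z)) / (1 + (q - z) / (q + z)))"
        by simp
      also have "1 - (q - z) / (q + z) = 2 * z / (q + z)"
        using z by (simp add: field_simps)
      also have "1 + (q - z) / (q + z) = 2 * q / (q + z)"
        using z by (simp add: field_simps)
      also have "q * (2 * z / (q + z) / (2 * q / (q + z))) = z" using z q0 by simp
      finally show ?thesis .
    qed
  qed
  have "openin (top_of_set (cball 0 1)) ?T"
    by (simp add: openin_delete)
  from homeomorphism_imp_open_embedding[OF hom this]
  show thesis by (rule that) (simp add: f_def algebra_simps)
qed

lemma surface_boundary_cball:
  "surface_boundary (top_of_set (cball 0 1 :: complex set)) = sphere 0 1"
proof -
  have "q \<in> surface_boundary (top_of_set (cball 0 1))" if "q \<in> sphere 0 1" for q :: complex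
  proof -
    obtain f where f: "open_embedding (top_of_set half_plane) (top_of_set (cball 0 1)) f" "f 0 = q"
      using cball_half_planar_at_sphere \<open>q \<in> sphere 0 1\<close> by auto
    then show ?thesis
      using half_plane_chart_boundary[OF _ f(1), of 0] by simp
  qed
  moreover have "planar_at (top_of_set (cball 0 1)) q" if q: "q \<in> ball 0 1" for q :: complex
  proof -
    have "openin (top_of_set (cball 0 1)) (ball (0 :: complex) 1)"
      by (simp add: open_subset ball_subset_cball)
    then have "open_embedding (top_of_set (ball (0 :: complex) 1)) (top_of_set (cball 0 1)) (\<lambda>x. x)"
      using open_embedding_inclusion ball_subset_cball
      by (metis inf.absorb2 subtopology_subtopology)
    then show ?thesis unfolding planar_at_def using q by blast
  qed
  ultimately show ?thesis
    unfolding surface_boundary_eq by (auto simp: less_eq_real_def)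
qed

section \<open>Gluing along the boundary\<close>

text \<open>The complement of \<open>A\<close> is the union of its traces on \<open>P\<close> and
  \<open>Q\<close>, both closed. With this, images under the glued chart can be tested for openness
  on each side separately.\<close>

lemma openin_closed_cover2:
  assumes P: "closedin Y P" "closedin Y Q" "P \<union> Q = topspace Y" and A: "A \<subseteq> topspace Y"
    and AP: "openin (subtopology Y P) (A \<inter> P)" and AQ: "openin (subtopology Y Q) (A \<inter> Q)"
  shows "openin Y A"
proof -
  have top: "topspace (subtopology Y P) = P" "topspace (subtopology Y Q) = Q" using P by auto
  have "closedin (subtopology Y P) (P - A \<inter> P)" "closedin (subtopology Y Q) (Q - A \<inter> Q)"
    using AP AQ top by (metis closedin_def Diff_Diff_Int openin_subset Diff_subset inf.absorb_iff2)+
  then have "closedin Y (P - A \<inter> P)" "closedin Y (Q - A \<inter> Q)"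
    using P closedin_trans_full by blast+
  then have "closedin Y ((P - A \<inter> P) \<union> (Q - A \<inter> Q))" by blast
  moreover have "(P - A \<inter> P) \<union> (Q - A \<inter> Q) = topspace Y - A" using P by blast
  ultimately show ?thesis using A by (simp add: openin_closedin)
qed

text \<open>The chart \<open>\<gamma>\<close> of the glued surface is the chart \<open>\<alpha>\<close> of \<open>P\<close> on the upper half plane, and on the
  lower half plane the chart \<open>\<beta>\<close> of \<open>Q\<close> reparametrised so that both agree on the real axis.\<close>

lemma planar_at_glued_boundary:
  assumes P: "closedin Y P" "closedin Y Q" "P \<union> Q = topspace Y"
    and bP: "surface_boundary (subtopology Y P) = P \<inter> Q"
    and bQ: "surface_boundary (subtopology Y Q) = P \<inter> Q"
    and p: "p \<in> P \<inter> Q"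
    and hP: "half_planar_at (subtopology Y P) p" and hQ: "half_planar_at (subtopology Y Q) p"
  shows "planar_at Y p"
proof -
  obtain \<alpha> where \<alpha>: "open_embedding (top_of_set half_box) (subtopology Y P) \<alpha>" "\<alpha> 0 = p"
    and \<alpha>C: "\<And>z. z \<in> half_box \<Longrightarrow> \<alpha> z \<in> P \<inter> Q \<longleftrightarrow> Im z = 0"
    using half_box_chart[OF hP] p bP by metis
  obtain \<beta> where \<beta>: "open_embedding (top_of_set half_box) (subtopology Y Q) \<beta>" "\<beta> 0 = p"
    and \<beta>C: "\<And>z. z \<in> half_box \<Longrightarrow> \<beta> z \<in> P \<inter> Q \<longleftrightarrow> Im z = 0"
    using half_box_chart[OF hQ] p bQ by metis
  let ?hb = "top_of_set half_box"
  have top: "topspace (subtopology Y P) = P" "topspace (subtopology Y Q) = Q" using P by auto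
  have \<alpha>c: "continuous_map ?hb Y \<alpha>" and \<beta>c: "continuous_map ?hb Y \<beta>"
    using \<alpha> \<beta> by (auto simp: open_embedding_def continuous_map_in_subtopology)
  have \<alpha>P: "\<alpha> z \<in> P" and \<beta>Q: "\<beta> z \<in> Q" if "z \<in> half_box" for z
    using that \<alpha> \<beta> by (auto simp: open_embedding_def continuous_map_in_subtopology)
  have \<alpha>i: "inj_on \<alpha> half_box" and \<beta>i: "inj_on \<beta> half_box"
    using open_embeddingD(3)[OF \<alpha>(1)] open_embeddingD(3)[OF \<beta>(1)] by auto
  let ?N = "\<beta> ` half_box"
  have "homeomorphic_map ?hb (subtopology (subtopology Y Q) ?N) \<beta>"
    using open_embedding_imp_homeomorphic_map[OF \<beta>(1)] by simp
  then obtain k where k: "homeomorphic_maps ?hb (subtopology (subtopology Y Q) ?N) \<beta> k"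
    by (auto simp: homeomorphic_map_maps)
  have topN: "topspace (subtopology (subtopology Y Q) ?N) = ?N"
    using \<beta>Q top P by auto
  have kc: "continuous_map (subtopology (subtopology Y Q) ?N) ?hb k"
    and \<beta>k: "\<And>y. y \<in> ?N \<Longrightarrow> \<beta> (k y) = y"
    using k topN by (auto simp: homeomorphic_maps_def)
  have kh: "k y \<in> half_box" if "y \<in> ?N" for y
    using kc that topN by (auto simp: continuous_map_def)
  \<comment> \<open>Near \<open>0\<close> on the axis, \<open>\<alpha>\<close> takes values in
    \<open>N0\<close>, and on the axis also in \<open>Q\<close>, hence in the range of
    \<open>\<beta>\<close>; the next steps make this quantitative.\<close>
  obtain N0 where N0: "openin Y N0" "?N = N0 \<inter> Q"
    using open_embeddingD(4)[OF \<beta>(1)] by (auto simp: openin_subtopology)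
  have "openin ?hb {z \<in> topspace ?hb. \<alpha> z \<in> N0}"
    by (rule openin_continuous_map_preimage[OF \<alpha>c N0(1)])
  then obtain T where T: "open T" "{z \<in> half_box. \<alpha> z \<in> N0} = half_box \<inter> T"
    by (auto simp: openin_open)
  have 0: "0 \<in> half_box" by (simp add: half_box_def)
  have "p \<in> ?N" using \<beta> 0 by force
  then have "0 \<in> T" using T N0 0 \<alpha> by blast
  then obtain e where e: "e > 0" "ball 0 e \<subseteq> T" using T openE by blast
  \<comment> \<open>The bound \<open>e\<close> keeps \<open>\<alpha>\<close> of the segment
    \<open>L\<close> inside the range of \<open>\<beta>\<close>; the bound 1 keeps \<open>L\<close>
    inside \<open>half_box\<close>.\<close>
  define \<delta> where "\<delta> = min e 1"
  have \<delta>: "\<delta> > 0" "\<delta> \<le> 1" "\<delta> \<le> e" using e by (auto simp: \<delta>_def)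
  define L where "L = {z. \<bar>Re z\<bar> < \<delta> \<and> Im z = 0}"
  have Lh: "L \<subseteq> half_box" using \<delta> by (auto simp: L_def half_box_def)
  have LN: "\<alpha> z \<in> ?N" "\<alpha> z \<in> P \<inter> Q" if z: "z \<in> L" for z
  proof -
    have "cmod z = \<bar>Re z\<bar>" using z by (simp add: L_def cmod_eq_Re)
    then have "z \<in> T" using e z \<delta> by (auto simp: L_def)
    then have "\<alpha> z \<in> N0" using T z Lh by blast
    moreover show "\<alpha> z \<in> P \<inter> Q" using \<alpha>C z Lh by (auto simp: L_def)
    ultimately show "\<alpha> z \<in> ?N" using N0 by blast
  qed
  \<comment> \<open>The change of charts along the seam: the point \<open>\<alpha> z\<close> is the
    point with \<open>\<beta>\<close>-coordinate \<open>\<kappa> z\<close>, again on the real axis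
    since both charts send exactly the axis into the seam.\<close>
  define \<kappa> where "\<kappa> = k \<circ> \<alpha>"
  have \<kappa>h: "\<kappa> z \<in> half_box" and \<beta>\<kappa>: "\<beta> (\<kappa> z) = \<alpha> z" if "z \<in> L" for z
    using that kh \<beta>k LN by (auto simp: \<kappa>_def)
  have \<kappa>0: "Im (\<kappa> z) = 0" if "z \<in> L" for z
    using \<beta>C[OF \<kappa>h[OF that]] \<beta>\<kappa>[OF that] LN[OF that] by simp
  have "continuous_map (top_of_set L) (subtopology (subtopology Y Q) ?N) \<alpha>"
  proof (intro continuous_map_into_subtopology)
    have "continuous_map (subtopology ?hb L) Y \<alpha>" using \<alpha>c by (rule continuous_map_from_subtopology)
    then show "continuous_map (top_of_set L) Y \<alpha>"
      using Lh by (simp add: subtopology_subtopology inf_absorb2)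
  qed (use LN in auto)
  then have "continuous_map (top_of_set L) ?hb \<kappa>"
    unfolding \<kappa>_def using kc continuous_map_compose by blast
  then have \<kappa>c: "continuous_on L \<kappa>" by simp
  define S where "S = {z. \<bar>Re z\<bar> < \<delta> \<and> \<bar>Im z\<bar> < 1}"
  have S: "open S"
    unfolding S_def by (intro open_Collect_conj open_Collect_less continuous_intros)
  \<comment> \<open>In coordinates, (x, y) goes to (\<open>\<kappa>\<close> x, -y): the lower half
    is reflected into the domain of \<open>\<beta>\<close>, and the seam parametrisation of
    \<open>\<beta>\<close> is corrected to that of \<open>\<alpha>\<close>. On the axis
    \<open>\<theta>\<close> reduces to \<open>\<kappa>\<close>, so the two halves fit
    together.\<close>
  define \<theta> where "\<theta> = (\<lambda>z. \<kappa> (complex_of_real (Re z)) - \<i> * complex_of_real (Im z))"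
  have SL: "complex_of_real (Re z) \<in> L" if "z \<in> S" for z
    using that by (auto simp: S_def L_def)
  have \<theta>Im: "Im (\<theta> z) = - Im z" and \<theta>Re: "Re (\<theta> z) = Re (\<kappa> (complex_of_real (Re z)))" if "z \<in> S" for z
    using \<kappa>0[OF SL[OF that]] by (auto simp: \<theta>_def)
  have \<theta>h: "\<theta> z \<in> half_box \<longleftrightarrow> Im z \<le> 0" if "z \<in> S" for z
    using \<theta>Im[OF that] \<theta>Re[OF that] \<kappa>h[OF SL[OF that]] that by (auto simp: half_box_def S_def)
  have \<theta>c: "continuous_on S \<theta>"
    unfolding \<theta>_def
    by (intro continuous_intros continuous_on_compose2[OF \<kappa>c]) (use SL in auto)
  have \<theta>i: "inj_on \<theta> S"
  proof (rule inj_onI)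
    fix z w assume z: "z \<in> S" and w: "w \<in> S" and eq: "\<theta> z = \<theta> w"
    have "Im z = Im w" using \<theta>Im[OF z] \<theta>Im[OF w] eq by simp
    moreover from this have "\<kappa> (complex_of_real (Re z)) = \<kappa> (complex_of_real (Re w))"
      using eq by (simp add: \<theta>_def)
    then have "\<alpha> (complex_of_real (Re z)) = \<alpha> (complex_of_real (Re w))"
      using \<beta>\<kappa>[OF SL[OF z]] \<beta>\<kappa>[OF SL[OF w]] by simp
    then have "complex_of_real (Re z) = complex_of_real (Re w)"
      using \<alpha>i SL[OF z] SL[OF w] Lh by (meson inj_onD subsetD)
    ultimately show "z = w" by (simp add: complex_eq_iff)
  qed
  define \<gamma> where "\<gamma> = (\<lambda>z. if 0 \<le> Im z then \<alpha> z else \<beta> (\<theta> z))"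
  have Sh: "z \<in> half_box \<longleftrightarrow> 0 \<le> Im z" if "z \<in> S" for z
    using that \<delta> by (auto simp: S_def half_box_def)
  have agree: "\<alpha> z = \<beta> (\<theta> z)" if "z \<in> S" "Im z = 0" for z
  proof -
    have "complex_of_real (Re z) = z" using that by (simp add: complex_eq_iff)
    then show ?thesis using \<beta>\<kappa>[OF SL[OF that(1)]] that by (simp add: \<theta>_def)
  qed
  have \<gamma>neg: "\<gamma> z \<in> Q - P" if "z \<in> S" "Im z < 0" for z
    using that \<theta>h[OF that(1)] \<theta>Im[OF that(1)] \<beta>C[of "\<theta> z"] \<beta>Q[of "\<theta> z"] by (auto simp: \<gamma>_def)
  have \<gamma>c: "continuous_map (top_of_set S) Y \<gamma>"
    unfolding \<gamma>_def
  proof (rule continuous_map_cases_le)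
    let ?A = "{z \<in> topspace (top_of_set S). 0 \<le> Im z}"
    have "continuous_map (subtopology ?hb ?A) Y \<alpha>" using \<alpha>c by (rule continuous_map_from_subtopology)
    moreover have "subtopology ?hb ?A = subtopology (top_of_set S) ?A"
      using Sh by (auto simp: subtopology_subtopology intro!: arg_cong[of _ _ "subtopology euclidean"])
    ultimately show "continuous_map (subtopology (top_of_set S) ?A) Y \<alpha>" by simp
    let ?B = "{z \<in> topspace (top_of_set S). Im z \<le> 0}"
    have "continuous_on ?B \<theta>" using \<theta>c by (rule continuous_on_subset) auto
    then have "continuous_map (top_of_set ?B) ?hb \<theta>" using \<theta>h by auto
    then have "continuous_map (top_of_set ?B) Y (\<beta> \<circ> \<theta>)"
      using \<beta>c continuous_map_compose by blast
    moreover have "subtopology (top_of_set S) ?B = top_of_set ?B"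
      by (simp add: subtopology_subtopology inf_absorb2 Collect_restrict)
    ultimately show "continuous_map (subtopology (top_of_set S) ?B) Y (\<lambda>z. \<beta> (\<theta> z))"
      by (simp add: comp_def)
  qed (use agree in \<open>auto intro: continuous_intros\<close>)
  have \<gamma>i: "inj_on \<gamma> S"
  proof (rule inj_onI)
    \<comment> \<open>The closed upper half is sent into \<open>P\<close> and the open lower half
      outside \<open>P\<close>, so equal values come from the same half, where injectivity of
      \<open>\<alpha>\<close>, or of \<open>\<beta>\<close> and \<open>\<theta>\<close>,
      applies.\<close>
    fix z w assume z: "z \<in> S" and w: "w \<in> S" and eq: "\<gamma> z = \<gamma> w"
    have iff: "0 \<le> Im z \<longleftrightarrow> 0 \<le> Im w"
      using \<gamma>neg[OF z] \<gamma>neg[OF w] \<alpha>P Sh[OF z] Sh[OF w] eq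
      by (metis DiffD2 \<gamma>_def linorder_not_le)
    show "z = w"
    proof (cases "0 \<le> Im z")
      case True
      then show ?thesis using \<alpha>i Sh[OF z] Sh[OF w] eq iff by (auto simp: \<gamma>_def inj_on_def)
    next
      case False
      then have "\<theta> z = \<theta> w"
        using \<beta>i \<theta>h[OF z] \<theta>h[OF w] eq iff by (auto simp: \<gamma>_def inj_on_def)
      then show ?thesis using \<theta>i z w by (simp add: inj_on_def)
    qed
  qed
  have "open_map (top_of_set S) Y \<gamma>"
    unfolding open_map_def
  proof (intro allI impI)
    fix O' assume "openin (top_of_set S) O'"
    then have O': "open O'" "O' \<subseteq> S" using S openin_open_eq by auto
    \<comment> \<open>The axis belongs to both traces: it is reached through \<open>\<alpha>\<close>
      in the trace on \<open>P\<close> and through \<open>\<beta>\<close> in the trace on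
      \<open>Q\<close>. Each trace is therefore the image of a relatively open subset of
      \<open>half_box\<close>.\<close>
    have 1: "\<gamma> ` O' \<inter> P = \<alpha> ` (half_box \<inter> O')"
    proof safe
      fix z assume z: "z \<in> O'" "\<gamma> z \<in> P"
      then have "0 \<le> Im z" using \<gamma>neg O' by force
      then show "\<gamma> z \<in> \<alpha> ` (half_box \<inter> O')" using z O' Sh by (auto simp: \<gamma>_def)
    next
      fix z assume z: "z \<in> half_box" "z \<in> O'"
      then show "\<alpha> z \<in> \<gamma> ` O'" using O' Sh by (intro image_eqI[of _ _ z]) (auto simp: \<gamma>_def)
    qed (use \<alpha>P in blast)
    have 2: "\<gamma> ` O' \<inter> Q = \<beta> ` (half_box \<inter> \<theta> ` O')"
    proof safe
      fix z assume z: "z \<in> O'" "\<gamma> z \<in> Q"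
      have zS: "z \<in> S" using z O' by blast
      have "Im z \<le> 0"
      proof (rule ccontr)
        assume "\<not> Im z \<le> 0"
        then show False using z \<alpha>C[of z] \<alpha>P[of z] Sh[OF zS] by (auto simp: \<gamma>_def)
      qed
      then have "\<gamma> z = \<beta> (\<theta> z)" using agree[OF zS] by (auto simp: \<gamma>_def)
      then show "\<gamma> z \<in> \<beta> ` (half_box \<inter> \<theta> ` O')" using \<theta>h[OF zS] \<open>Im z \<le> 0\<close> z by blast
    next
      fix z assume z: "\<theta> z \<in> half_box" "z \<in> O'"
      then have zS: "z \<in> S" using O' by blast
      then have "Im z \<le> 0" using \<theta>h z by blast
      then have "\<gamma> z = \<beta> (\<theta> z)" using agree[OF zS] by (auto simp: \<gamma>_def)
      then show "\<beta> (\<theta> z) \<in> \<gamma> ` O'" using z by force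
    qed (use \<beta>Q in blast)
    \<comment> \<open>Invariance of domain spares an inspection of the inverse of
      \<open>\<theta>\<close>.\<close>
    have "open (\<theta> ` O')"
      using invariance_of_domain O' \<theta>c \<theta>i by (metis continuous_on_subset inj_on_subset)
    then have "openin ?hb (half_box \<inter> \<theta> ` O')" "openin ?hb (half_box \<inter> O')"
      using O' by (auto simp: openin_open)
    then have "openin (subtopology Y P) (\<gamma> ` O' \<inter> P)" "openin (subtopology Y Q) (\<gamma> ` O' \<inter> Q)"
      unfolding 1 2 using \<alpha> \<beta> by (auto simp: open_embedding_def open_map_def)
    moreover have "\<gamma> ` O' \<subseteq> topspace Y"
      using \<gamma>c O' by (auto simp: continuous_map_def)
    ultimately show "openin Y (\<gamma> ` O')"
      using openin_closed_cover2[OF P] by blast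
  qed
  then have "open_embedding (top_of_set S) Y \<gamma>"
    using \<gamma>c \<gamma>i by (simp add: open_embedding_def)
  moreover have "0 \<in> S" using \<delta> by (simp add: S_def)
  then have "p \<in> \<gamma> ` S" using \<alpha>(2) by (intro image_eqI[of _ _ 0]) (auto simp: \<gamma>_def)
  ultimately show ?thesis unfolding planar_at_def using S by blast
qed

section \<open>Finiteness of the number of boundary components\<close>

text \<open>The boundary is closed in a compact space, and every point of it has a half-box chart
  that cuts out an interval of the boundary. Finitely many of these connected traces cover the
  boundary, and each lies in a single component.\<close>

lemma finite_boundary_components:
  assumes X: "compact_space X"
    and half: "\<And>p. p \<in> surface_boundary X \<Longrightarrow> half_planar_at X p"
  shows "finite (connected_components_of (subtopology X (surface_boundary X)))"
proof -
  let ?B = "subtopology X (surface_boundary X)"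
  have top: "topspace ?B = surface_boundary X" using surface_boundary_subset[of X] by auto
  define \<U> where "\<U> = {U. openin X U \<and> connectedin ?B (U \<inter> surface_boundary X)}"
  have "compactin X (surface_boundary X)"
    using X closedin_compact_space closedin_surface_boundary by blast
  moreover have "surface_boundary X \<subseteq> \<Union>\<U>"
  proof
    fix p assume p: "p \<in> surface_boundary X"
    obtain f where f: "open_embedding (top_of_set half_box) X f" "f 0 = p"
      and fb: "\<And>z. z \<in> half_box \<Longrightarrow> f z \<in> surface_boundary X \<longleftrightarrow> Im z = 0"
      using half_box_chart[OF half[OF p] p] by metis
    let ?L = "half_box \<inter> {z. Im z = 0}"
    have "convex ({z. Re z < 1} \<inter> {z. Re z > -1} \<inter> {z. Im z = 0})"
      by (intro convex_Int convex_halfspace_Re_lt convex_halfspace_Re_gt)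
        (auto simp: convex_def)
    moreover have "?L = {z. Re z < 1} \<inter> {z. Re z > -1} \<inter> {z. Im z = 0}"
      by (auto simp: half_box_def)
    ultimately have "connected ?L" using convex_connected by metis
    then have "connectedin (top_of_set half_box) ?L"
      by (simp add: connectedin_subtopology)
    then have "connectedin X (f ` ?L)"
      using connectedin_continuous_map_image open_embeddingD(1)[OF f(1)] by blast
    moreover have "f ` half_box \<inter> surface_boundary X = f ` ?L" using fb by auto
    ultimately have "f ` half_box \<in> \<U>"
      using open_embeddingD(4)[OF f(1)] by (auto simp: \<U>_def connectedin_subtopology)
    moreover have "p \<in> f ` half_box" using f(2) by (intro image_eqI[of _ _ 0]) (auto simp: half_box_def)
    ultimately show "p \<in> \<Union>\<U>" by blast
  qed
  moreover have "\<forall>U\<in>\<U>. openin X U" by (simp add: \<U>_def)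
  ultimately obtain \<F> where \<F>: "finite \<F>" "\<F> \<subseteq> \<U>" "surface_boundary X \<subseteq> \<Union>\<F>"
    unfolding compactin_def by meson
  \<comment> \<open>A component meets some member of the finite cover and, as the trace of that
    member is connected, contains the whole trace. Hence the point of the trace picked by
    \<open>SOME\<close> represents the component.\<close>
  have "connected_components_of ?B \<subseteq>
      (\<lambda>U. connected_component_of_set ?B (SOME x. x \<in> U \<inter> surface_boundary X)) ` \<F>"
  proof
    fix K assume "K \<in> connected_components_of ?B"
    then obtain x where x: "x \<in> surface_boundary X" "K = connected_component_of_set ?B x"
      using top by (auto simp: connected_components_of_def)
    then obtain U where U: "U \<in> \<F>" "x \<in> U" using \<F> by blast
    define y where "y = (SOME x. x \<in> U \<inter> surface_boundary X)"
    have y: "y \<in> U \<inter> surface_boundary X"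
      unfolding y_def by (rule someI[of _ x]) (use x U in blast)
    have "connectedin ?B (U \<inter> surface_boundary X)" using U \<F> by (auto simp: \<U>_def)
    then have "connected_component_of ?B x y"
      unfolding connected_component_of_def using x U y by blast
    then have "K = connected_component_of_set ?B y"
      using x by (metis connected_component_of_equiv)
    then show "K \<in> (\<lambda>U. connected_component_of_set ?B (SOME x. x \<in> U \<inter> surface_boundary X)) ` \<F>"
      using U y_def by blast
  qed
  then show ?thesis using \<F> finite_surj by blast
qed

section \<open>Ribbon graphs and their capped surfaces\<close>

lemma homeomorphic_map_restrict_embedding:
  assumes "embedding_map X Y i" "S \<subseteq> topspace X"
  shows "homeomorphic_map (subtopology X S) (subtopology Y (i ` S)) i"
proof -
  have i: "homeomorphic_map X (subtopology Y (i ` topspace X)) i"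
    using assms(1) by (simp add: embedding_map_def)
  have im: "i ` topspace X \<subseteq> topspace Y"
    using homeomorphic_imp_surjective_map[OF i] by (metis inf.cobounded1 topspace_subtopology)
  have "i ` (topspace X \<inter> S) = topspace (subtopology Y (i ` topspace X)) \<inter> i ` S"
    using assms(2) im by auto
  from homeomorphic_map_subtopologies[OF i this] show ?thesis
    using assms(2) by (simp add: subtopology_subtopology image_mono inf_absorb2)
qed

lemma closed_disc_chart:
  assumes "is_closed_disc X d"
  obtains h where "homeomorphic_map (top_of_set (cball (0 :: complex) 1)) (subtopology X d) h"
    "h ` cball 0 1 = d" "h ` sphere 0 1 = disc_boundary X d"
proof -
  obtain h where h: "homeomorphic_map (top_of_set (cball (0 :: complex) 1)) (subtopology X d) h"
    using assms unfolding is_closed_disc_def by (metis homeomorphic_space homeomorphic_space_sym)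
  moreover have "h ` cball 0 1 = d"
    using homeomorphic_imp_surjective_map[OF h] assms by (simp add: is_closed_disc_def inf_absorb2)
  moreover have "h ` sphere 0 1 = disc_boundary X d"
    using surface_boundary_homeomorphic_map[OF h]
    by (simp add: surface_boundary_cball disc_boundary_def)
  ultimately show thesis by (rule that)
qed

lemma disc_boundary_subset: "disc_boundary X d \<subseteq> d"
  using surface_boundary_subset[of "subtopology X d"] by (auto simp: disc_boundary_def)

lemma closed_disc_chart_continuous:
  assumes "homeomorphic_map (top_of_set S) (subtopology X d) h"
  shows "continuous_map (top_of_set S) X h"
  using homeomorphic_imp_continuous_map[OF assms] by (simp add: continuous_map_in_subtopology)

lemma closed_disc_compactin:
  assumes "is_closed_disc X d" shows "compactin X d"
proof -
  obtain h where h: "homeomorphic_map (top_of_set (cball (0 :: complex) 1)) (subtopology X d) h"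
    and d: "h ` cball 0 1 = d"
    using closed_disc_chart[OF assms] by metis
  have "compactin (top_of_set (cball (0 :: complex) 1)) (cball 0 1)"
    by (simp add: compactin_subtopology)
  from image_compactin[OF this closed_disc_chart_continuous[OF h]] show ?thesis using d by simp
qed

lemma closed_disc_nonempty: "is_closed_disc X d \<Longrightarrow> d \<noteq> {}"
  by (metis closed_disc_chart image_is_empty cball_eq_empty not_one_less_zero)

lemma disc_boundary_nonempty:
  assumes "is_closed_disc X d" shows "disc_boundary X d \<noteq> {}"
proof -
  have "(1 :: complex) \<in> sphere 0 1" by simp
  then show ?thesis using closed_disc_chart[OF assms] by (metis empty_iff imageI)
qed

lemma connectedin_disc_boundary:
  assumes "is_closed_disc X d" shows "connectedin X (disc_boundary X d)"
proof -
  obtain h where h: "homeomorphic_map (top_of_set (cball (0 :: complex) 1)) (subtopology X d) h"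
    and d: "h ` sphere 0 1 = disc_boundary X d"
    using closed_disc_chart[OF assms] by metis
  have "connected (sphere (0 :: complex) 1)" by (rule connected_sphere) simp
  then have "connectedin (top_of_set (cball (0 :: complex) 1)) (sphere 0 1)"
    by (auto simp: connectedin_subtopology)
  from connectedin_continuous_map_image[OF closed_disc_chart_continuous[OF h] this]
  show ?thesis using d by simp
qed

lemma disc_boundary_half_planar:
  assumes "is_closed_disc X d" "p \<in> disc_boundary X d"
  shows "half_planar_at (subtopology X d) p"
proof -
  obtain h where h: "homeomorphic_map (top_of_set (cball (0 :: complex) 1)) (subtopology X d) h"
    and d: "h ` sphere 0 1 = disc_boundary X d"
    using closed_disc_chart[OF assms(1)] by metis
  have "p \<in> h ` sphere 0 1" using d assms(2) by simp
  then obtain q where q: "cmod q = 1" "p = h q" by auto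
  obtain f where f: "open_embedding (top_of_set half_plane) (top_of_set (cball 0 1)) f" "f 0 = q"
    using cball_half_planar_at_sphere[OF q(1)] by metis
  have "half_planar_at (top_of_set (cball 0 1)) q"
    unfolding half_planar_at_def
  proof (intro exI conjI)
    show "openin (top_of_set half_plane) half_plane" by simp
    show "q \<in> f ` half_plane" using f(2) by (intro image_eqI[of _ _ 0]) auto
  qed (rule f(1))
  then show ?thesis
    unfolding q(2)
    by (rule half_planar_at_open_embedding) (rule homeomorphic_map_imp_open_embedding[OF h])
qed

text \<open>The open unit ball is dense in the closed one, and disc charts carry it to the disc
  without its boundary circle. This feeds the density hypothesis of
  \<open>surface_boundary_of_piece\<close>.\<close>

lemma disc_subset_closure_of_interior:
  assumes "is_closed_disc X d" shows "d \<subseteq> X closure_of (d - disc_boundary X d)"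
proof -
  obtain h where h: "homeomorphic_map (top_of_set (cball (0 :: complex) 1)) (subtopology X d) h"
    and d: "h ` cball 0 1 = d" "h ` sphere 0 1 = disc_boundary X d"
    using closed_disc_chart[OF assms] by metis
  have inj: "inj_on h (cball 0 1)"
    using homeomorphic_imp_injective_map[OF h] by simp
  have eq: "h ` ball 0 1 = d - disc_boundary X d"
  proof -
    have "(ball 0 1 :: complex set) = cball 0 1 - sphere 0 1" by auto
    then show ?thesis using inj_on_image_set_diff[OF inj, of "cball 0 1" "sphere 0 1"] d by auto
  qed
  have "(top_of_set (cball (0 :: complex) 1)) closure_of (ball 0 1) = cball 0 1"
    by (simp add: closure_of_subtopology inf_absorb2)
  then show ?thesis
    using continuous_map_image_closure_subset[OF closed_disc_chart_continuous[OF h], of "ball 0 1"]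
    by (simp add: eq d)
qed

lemma embedding_closed_disc:
  assumes i: "embedding_map X Y i" and d: "is_closed_disc X d"
  shows "is_closed_disc Y (i ` d)" "disc_boundary Y (i ` d) = i ` disc_boundary X d"
proof -
  have dX: "d \<subseteq> topspace X" using d by (simp add: is_closed_disc_def)
  have h: "homeomorphic_map (subtopology X d) (subtopology Y (i ` d)) i"
    using homeomorphic_map_restrict_embedding[OF i dX] .
  have "i ` topspace X \<subseteq> topspace Y"
    using i by (metis embedding_map_def homeomorphic_imp_surjective_map inf.cobounded1 topspace_subtopology)
  moreover have "subtopology Y (i ` d) homeomorphic_space top_of_set (cball (0 :: complex) 1)"
    using d h unfolding is_closed_disc_def
    by (metis homeomorphic_map_imp_homeomorphic_space homeomorphic_space_sym homeomorphic_space_trans)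
  ultimately show "is_closed_disc Y (i ` d)"
    using dX unfolding is_closed_disc_def by auto
  show "disc_boundary Y (i ` d) = i ` disc_boundary X d"
    using surface_boundary_homeomorphic_map[OF h] by (simp add: disc_boundary_def)
qed

lemma closedin_Union_closed_discs:
  assumes "Hausdorff_space Y" "finite \<D>" "\<And>d. d \<in> \<D> \<Longrightarrow> is_closed_disc Y d"
  shows "closedin Y (\<Union>\<D>)"
  using assms by (intro closedin_Union) (auto intro: compactin_imp_closedin closed_disc_compactin)

text \<open>By \<open>meet\<close> the interior of every disc in \<open>\<L>\<close> avoids
  \<open>\<K>\<close>, and it is dense in its disc; so every point of the union of
  \<open>\<L>\<close> is a limit of points outside the union of \<open>\<K>\<close>.\<close>

lemma surface_boundary_Union_closed_discs:
  assumes Y: "Hausdorff_space Y" "\<And>p. p \<in> topspace Y \<Longrightarrow> planar_at Y p"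
    and fin: "finite \<K>" "finite \<L>"
    and disc: "\<And>d. d \<in> \<K> \<union> \<L> \<Longrightarrow> is_closed_disc Y d"
    and cover: "\<Union>\<K> \<union> \<Union>\<L> = topspace Y"
    and meet: "\<And>d. d \<in> \<L> \<Longrightarrow> d \<inter> \<Union>\<K> \<subseteq> disc_boundary Y d"
  shows "surface_boundary (subtopology Y (\<Union>\<K>)) = \<Union>\<K> \<inter> \<Union>\<L>"
proof (rule surface_boundary_of_piece[OF Y(2) _ _ cover])
  show "closedin Y (\<Union>\<K>)" "closedin Y (\<Union>\<L>)"
    using closedin_Union_closed_discs Y(1) fin disc by (metis UnCI)+
  show "\<Union>\<K> \<inter> \<Union>\<L> \<subseteq> Y closure_of (\<Union>\<L> - \<Union>\<K>)"
  proof clarify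
    fix p d assume p: "p \<in> d" "d \<in> \<L>"
    have "d \<subseteq> Y closure_of (d - disc_boundary Y d)"
      using disc_subset_closure_of_interior disc p by blast
    moreover have "d - disc_boundary Y d \<subseteq> \<Union>\<L> - \<Union>\<K>"
      using p meet by blast
    ultimately show "p \<in> Y closure_of (\<Union>\<L> - \<Union>\<K>)"
      using p(1) closure_of_mono by blast
  qed
qed auto

text \<open>As the family is finite, the union of all other members is closed, so each member is
  clopen; a connected nonempty clopen set is a component.\<close>

lemma connected_components_of_disjoint_closed_union:
  assumes fin: "finite \<C>" and disj: "disjoint \<C>" and cover: "\<Union>\<C> = topspace X"
    and C: "\<And>C. C \<in> \<C> \<Longrightarrow> closedin X C \<and> connectedin X C \<and> C \<noteq> {}"
  shows "connected_components_of X = \<C>"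
proof -
  have comp: "connected_component_of_set X x = C" if "x \<in> C" "C \<in> \<C>" for x C
  proof (rule connected_component_of_unique)
    fix C' assume C': "x \<in> C' \<and> connectedin X C'"
    have "closedin X (\<Union>(\<C> - {C}))" using fin C by (intro closedin_Union) auto
    moreover have "topspace X - \<Union>(\<C> - {C}) = C"
      using disj that cover by (fastforce simp: disjoint_def)
    ultimately have "openin X C" by (metis openin_diff openin_topspace)
    then show "C' \<subseteq> C"
      using C' C[OF that(2)] that(1) connectedin_clopen_cases[of X C' C] by (auto simp: disjnt_iff)
  qed (use that C in auto)
  show ?thesis
  proof
    show "connected_components_of X \<subseteq> \<C>"
    proof
      fix K assume "K \<in> connected_components_of X"
      then obtain x where "x \<in> \<Union>\<C>" "K = connected_component_of_set X x"
        unfolding connected_components_of_def cover by blast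
      then show "K \<in> \<C>" using comp by auto
    qed
    show "\<C> \<subseteq> connected_components_of X"
    proof
      fix K assume K: "K \<in> \<C>"
      then obtain x where "x \<in> K" using C by blast
      then show "K \<in> connected_components_of X"
        using comp K cover unfolding connected_components_of_def by blast
    qed
  qed
qed

section \<open>Intersections and boundary components in a ribbon graph\<close>

locale ribbon =
  fixes G :: "('a, 'm) ribbon_graph_scheme"
  assumes ribbon: "is_ribbon_graph G"
begin

abbreviation "X \<equiv> surf G"
abbreviation "V \<equiv> verts G"
abbreviation "E \<equiv> edges G"

lemma finite_pieces: "finite V" "finite E"
  and topspace_surf: "topspace X = \<Union>V \<union> \<Union>E"
  and disjoint_pieces: "disjoint V" "disjoint E"
  and Hausdorff_surf: "Hausdorff_space X"
  using ribbon by (simp_all add: is_ribbon_graph_def surface_with_boundary_def)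

lemma piece_disc:
  assumes "d \<in> V \<union> E" shows "is_closed_disc X d"
proof -
  have "\<forall>d \<in> V \<union> E. is_closed_disc X d" using ribbon unfolding is_ribbon_graph_def by (elim conjE)
  then show ?thesis using assms by blast
qed

lemma half_planar_surf: "p \<in> topspace X \<Longrightarrow> half_planar_at X p"
  using ribbon by (simp add: is_ribbon_graph_def surface_with_boundary_half_planar)

lemma segment_in_boundaries:
  assumes "s \<in> segments G"
  shows "\<exists>v\<in>V. s \<subseteq> disc_boundary X v" "\<exists>e\<in>E. s \<subseteq> disc_boundary X e"
proof -
  have "\<forall>s \<in> segments G. is_line_segment X s \<and>
        (\<exists>!v. v \<in> V \<and> s \<subseteq> disc_boundary X v) \<and> (\<exists>!e. e \<in> E \<and> s \<subseteq> disc_boundary X e)"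
    using ribbon unfolding is_ribbon_graph_def by (elim conjE)
  then show "\<exists>v\<in>V. s \<subseteq> disc_boundary X v" "\<exists>e\<in>E. s \<subseteq> disc_boundary X e"
    using assms by (meson ex1_implies_ex)+
qed

lemma compact_surf: "compact_space X"
proof -
  have "compactin X (\<Union>(V \<union> E))"
    using finite_pieces by (intro compactin_Union) (auto intro: closed_disc_compactin piece_disc)
  then show ?thesis by (simp add: compact_space_def topspace_surf)
qed

text \<open>The definition speaks only of segments of the total intersection. The segment through a
  common point lies on the boundary of some vertex and some edge, and disjointness of the vertices
  and of the edges forces these to be \<open>v\<close> and \<open>e\<close>.\<close>

lemma vertex_edge_meet:
  assumes v: "v \<in> V" and e: "e \<in> E"
  shows "v \<inter> e \<subseteq> disc_boundary X v \<inter> disc_boundary X e"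
proof
  fix p assume p: "p \<in> v \<inter> e"
  have "p \<in> topspace (subtopology X (\<Union>V \<inter> \<Union>E))"
    using p v e by (auto simp: topspace_surf)
  then obtain s where s: "s \<in> segments G" "p \<in> s"
    unfolding segments_def by (metis Union_connected_components_of UnionE)
  obtain v' e' where v': "v' \<in> V" "s \<subseteq> disc_boundary X v'" and e': "e' \<in> E" "s \<subseteq> disc_boundary X e'"
    using segment_in_boundaries[OF s(1)] by blast
  have "p \<in> v'" "p \<in> e'"
    using v' e' s(2) disc_boundary_subset[of X v'] disc_boundary_subset[of X e'] by blast+
  then have "v' = v" "e' = e"
    using p disjointD[OF disjoint_pieces(1) v'(1) v] disjointD[OF disjoint_pieces(2) e'(1) e]
    by blast+
  then show "p \<in> disc_boundary X v \<inter> disc_boundary X e" using v' e' s by auto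
qed

lemma faces_eq: "faces G = connected_components_of (subtopology X (surface_boundary X))"
  unfolding boundary_components_def Let_def using topspace_surf by (metis subtopology_topspace)

lemma Union_faces: "\<Union>(faces G) = surface_boundary X"
  using Union_connected_components_of surface_boundary_subset
  by (metis faces_eq inf.absorb2 topspace_subtopology)

lemma finite_faces: "finite (faces G)"
  unfolding faces_eq
  by (rule finite_boundary_components[OF compact_surf])
    (meson half_planar_surf subsetD surface_boundary_subset)

lemma face_subset: "f \<in> faces G \<Longrightarrow> f \<subseteq> topspace X"
  using Union_faces surface_boundary_subset[of X] by blast

text \<open>Each vertex disc is open in the union of the vertices, because the other discs form a
  finite closed union. The boundary thus splits into the vertex circles, which are disjoint, closed
  and connected.\<close>

lemma boundary_components_no_edges:
  "boundary_components G {} = disc_boundary X ` V"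
proof -
  let ?S = "subtopology X (\<Union>V)"
  have vX: "v \<subseteq> topspace X" if "v \<in> V" for v using that topspace_surf by blast
  have cl: "closedin X v" if "v \<in> V" for v
    using that piece_disc closed_disc_compactin Hausdorff_surf compactin_imp_closedin by blast
  have op: "openin ?S v" if v: "v \<in> V" for v
  proof -
    have "closedin X (\<Union>(V - {v}))" using finite_pieces cl by (intro closedin_Union) auto
    then have "closedin ?S (\<Union>(V - {v}))" by (auto intro!: closedin_subset_topspace)
    moreover have "v \<inter> w = {}" if "w \<in> V - {v}" for w
      using that disjointD[OF disjoint_pieces(1) v, of w] by auto
    then have "topspace ?S - \<Union>(V - {v}) = v"
      using v vX[OF v] topspace_surf by auto
    ultimately show ?thesis by (metis openin_diff openin_topspace)
  qed
  have part: "v \<inter> surface_boundary ?S = disc_boundary X v" if v: "v \<in> V" for v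
    using surface_boundary_open_subtopology[OF op[OF v]] v
    by (simp add: disc_boundary_def subtopology_subtopology Union_upper inf_absorb2)
  have b: "surface_boundary ?S = \<Union>(disc_boundary X ` V)"
  proof -
    have "surface_boundary ?S = (\<Union>v\<in>V. v \<inter> surface_boundary ?S)"
      using surface_boundary_subset[of ?S] by auto
    also have "\<dots> = (\<Union>v\<in>V. disc_boundary X v)" using part by (intro SUP_cong) auto
    finally show ?thesis by simp
  qed
  have "connected_components_of (subtopology ?S (surface_boundary ?S)) = disc_boundary X ` V"
  proof (rule connected_components_of_disjoint_closed_union)
    show "disjoint (disc_boundary X ` V)"
    proof (rule disjointI; clarify)
      fix v w assume "v \<in> V" "w \<in> V" "disc_boundary X v \<noteq> disc_boundary X w"
      then have "v \<inter> w = {}" using disjointD[OF disjoint_pieces(1)] by blast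
      then show "disc_boundary X v \<inter> disc_boundary X w = {}"
        using disc_boundary_subset[of X v] disc_boundary_subset[of X w] by blast
    qed
    show "\<Union>(disc_boundary X ` V) = topspace (subtopology ?S (surface_boundary ?S))"
      using b surface_boundary_subset[of ?S] by auto
    fix C assume "C \<in> disc_boundary X ` V"
    then obtain v where v: "v \<in> V" "C = disc_boundary X v" by blast
    have "closedin ?S v" using cl[OF v(1)] v(1) by (auto intro!: closedin_subset_topspace)
    then have "closedin (subtopology ?S (surface_boundary ?S)) (v \<inter> surface_boundary ?S)"
      by (auto simp: closedin_subtopology)
    moreover have "connectedin (subtopology ?S (surface_boundary ?S)) C"
      using connectedin_disc_boundary[OF piece_disc] v part[OF v(1)]
      by (auto simp: connectedin_subtopology)
    moreover have "C \<noteq> {}" using disc_boundary_nonempty piece_disc v by blast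
    ultimately show "closedin (subtopology ?S (surface_boundary ?S)) C \<and>
        connectedin (subtopology ?S (surface_boundary ?S)) C \<and> C \<noteq> {}"
      using part v by simp
  qed (use finite_pieces in auto)
  then show ?thesis by (simp add: boundary_components_def Let_def)
qed

lemma inj_on_disc_boundary: "inj_on (disc_boundary X) V"
proof (rule inj_onI)
  fix v w assume v: "v \<in> V" "w \<in> V" "disc_boundary X v = disc_boundary X w"
  then have "disc_boundary X v \<noteq> {}" using disc_boundary_nonempty piece_disc by blast
  then have "v \<inter> w \<noteq> {}"
    using v(3) disc_boundary_subset[of X v] disc_boundary_subset[of X w] by blast
  then show "v = w" using disjointD[OF disjoint_pieces(1) v(1,2)] by blast
qed

lemma card_boundary_components_no_edges: "card (boundary_components G {}) = card V"
  using boundary_components_no_edges inj_on_disc_boundary by (simp add: card_image)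

end

section \<open>Local planarity of the capped surface\<close>

locale capped_ribbon = ribbon +
  fixes Y :: "'c topology" and i :: "'a \<Rightarrow> 'c" and D :: "'a set \<Rightarrow> 'c set"
  assumes capping: "capping_off G Y i D"
begin

lemma Hausdorff_capped: "Hausdorff_space Y"
  and embedding: "embedding_map X Y i"
  and topspace_capped: "topspace Y = i ` topspace X \<union> (\<Union>f\<in>faces G. D f)"
  and cap_disc: "f \<in> faces G \<Longrightarrow> is_closed_disc Y (D f)"
  and cap_boundary: "f \<in> faces G \<Longrightarrow> disc_boundary Y (D f) = i ` f"
  and cap_meet: "f \<in> faces G \<Longrightarrow> D f \<inter> i ` topspace X = i ` f"
  and cap_disjoint: "f \<in> faces G \<Longrightarrow> g \<in> faces G \<Longrightarrow> f \<noteq> g \<Longrightarrow> D f \<inter> D g = {}"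
  using capping by (simp_all add: capping_off_def)

lemma homeomorphic_map_surf: "homeomorphic_map X (subtopology Y (i ` topspace X)) i"
  using embedding by (simp add: embedding_map_def)

lemma inj_on_surf: "inj_on i (topspace X)"
  using homeomorphic_imp_injective_map[OF homeomorphic_map_surf] .

lemma closedin_surf_image: "closedin Y (i ` topspace X)"
proof -
  have "continuous_map X Y i"
    using homeomorphic_imp_continuous_map[OF homeomorphic_map_surf]
    by (simp add: continuous_map_in_subtopology)
  then show ?thesis
    using compact_surf image_compactin compactin_imp_closedin Hausdorff_capped
    unfolding compact_space_def by blast
qed

lemma closedin_caps: "F \<subseteq> faces G \<Longrightarrow> closedin Y (\<Union>f\<in>F. D f)"
  using closedin_Union_closed_discs[OF Hausdorff_capped, of "D ` F"] finite_faces cap_disc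
  by (auto dest: finite_subset)

text \<open>After removal of the other caps, an open subset \<open>?Z\<close> of \<open>Y\<close>
  remains that is covered by two closed pieces, the rest of the surface and the cap
  \<open>D f\<close>. They meet exactly in the circle that bounds both, so the gluing lemma applies
  in \<open>?Z\<close>.\<close>

lemma planar_at_capped_seam:
  assumes f: "f \<in> faces G" and p: "p \<in> i ` f"
  shows "planar_at Y p"
proof -
  let ?X' = "i ` topspace X"
  let ?R = "\<Union>g\<in>faces G - {f}. D g"
  let ?U = "topspace Y - ?R"
  have U: "openin Y ?U" using closedin_caps[of "faces G - {f}"] by blast
  let ?Z = "subtopology Y ?U"
  let ?P = "?X' - ?R"
  have X'Y: "?X' \<subseteq> topspace Y" and DY: "D f \<subseteq> topspace Y" using topspace_capped f by auto
  have DR: "D f \<inter> ?R = {}" using cap_disjoint f by blast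
  have ifD: "i ` f \<subseteq> D f" "i ` f \<subseteq> ?X'" using cap_meet[OF f] by auto
  have fR: "i ` f \<inter> ?R = {}" using ifD DR by blast
  have PQ: "?P \<inter> D f = i ` f" using cap_meet[OF f] fR DR by blast
  have sub: "subtopology ?Z ?P = subtopology Y ?P" "subtopology ?Z (D f) = subtopology Y (D f)"
    using X'Y DY DR
    by (auto simp: subtopology_subtopology intro!: arg_cong[of _ _ "subtopology Y"])
  have oP: "openin (subtopology Y ?X') ?P"
  proof -
    have "?P = ?X' \<inter> ?U" using X'Y by blast
    then show ?thesis using U by (metis openin_subtopology_Int2)
  qed
  have sP: "subtopology (subtopology Y ?X') ?P = subtopology Y ?P"
    by (simp add: subtopology_subtopology inf_absorb2 Diff_subset)
  \<comment> \<open>Passing to \<open>?P\<close> discards the boundary components other than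
    \<open>f\<close>, since the image of each lies in its own cap and so in
    \<open>?R\<close>.\<close>
  have "surface_boundary (subtopology Y ?P) = ?P \<inter> i ` surface_boundary X"
    using surface_boundary_open_subtopology[OF oP] surface_boundary_homeomorphic_map[OF homeomorphic_map_surf]
    by (simp add: sP)
  also have "\<dots> = i ` f"
  proof
    show "?P \<inter> i ` surface_boundary X \<subseteq> i ` f"
    proof
      fix q assume q: "q \<in> ?P \<inter> i ` surface_boundary X"
      then obtain g where g: "g \<in> faces G" "q \<in> i ` g" using Union_faces by blast
      then have "q \<in> D g" using cap_meet by blast
      then show "q \<in> i ` f" using q g by blast
    qed
    show "i ` f \<subseteq> ?P \<inter> i ` surface_boundary X" using ifD fR f Union_faces by blast
  qed
  finally have bP: "surface_boundary (subtopology Y ?P) = i ` f" .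
  have "planar_at ?Z p"
  proof (rule planar_at_glued_boundary[of _ ?P "D f"])
    show "closedin ?Z ?P" "closedin ?Z (D f)"
    proof -
      have "?P = ?X' \<inter> ?U" "D f = D f \<inter> ?U" using X'Y DY DR by blast+
      moreover have "closedin Y (D f)" using closedin_caps[of "{f}"] f by simp
      ultimately show "closedin ?Z ?P" "closedin ?Z (D f)"
        using closedin_surf_image closedin_subtopology by metis+
    qed
    show "?P \<union> D f = topspace ?Z" using topspace_capped f DR by auto
    show "surface_boundary (subtopology ?Z ?P) = ?P \<inter> D f" unfolding sub PQ by (rule bP)
    show "surface_boundary (subtopology ?Z (D f)) = ?P \<inter> D f"
      unfolding sub PQ using cap_boundary[OF f] by (simp add: disc_boundary_def)
    show "p \<in> ?P \<inter> D f" using PQ p by blast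
    show "half_planar_at (subtopology ?Z (D f)) p"
      unfolding sub using disc_boundary_half_planar cap_disc cap_boundary f p by metis
    obtain x where x: "x \<in> f" "p = i x" using p by blast
    then have "half_planar_at X x" using half_planar_surf face_subset[OF f] by blast
    then have "half_planar_at (subtopology Y ?X') p"
      unfolding x(2)
      by (rule half_planar_at_open_embedding)
        (rule homeomorphic_map_imp_open_embedding[OF homeomorphic_map_surf])
    moreover have "p \<in> ?P" using p ifD fR by blast
    ultimately show "half_planar_at (subtopology ?Z ?P) p"
      unfolding sub
      using half_planar_at_open_embedding_iff[OF open_embedding_inclusion[OF oP], of p] X'Y
      by (auto simp: sP)
  qed
  moreover have "p \<in> ?U" using p fR ifD X'Y by blast
  ultimately show ?thesis
    using planar_at_open_embedding[OF open_embedding_inclusion[OF U], of p] by auto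
qed

lemma planar_at_capped:
  assumes p: "p \<in> topspace Y"
  shows "planar_at Y p"
proof -
  let ?X' = "i ` topspace X"
  have "p \<in> ?X' \<union> (\<Union>f\<in>faces G. D f)" using p by (simp only: topspace_capped)
  then consider f where "f \<in> faces G" "p \<in> i ` f"
    | f where "f \<in> faces G" "p \<in> D f" "p \<notin> i ` f"
    | "p \<in> ?X'" "p \<notin> (\<Union>f\<in>faces G. D f)"
    by blast
  then show ?thesis
  proof cases
    case 1
    then show ?thesis by (rule planar_at_capped_seam)
  next
    case 2
    \<comment> \<open>By the covering of \<open>Y\<close>, only points of \<open>D f\<close> survive
      these removals, so \<open>?U\<close> is an open neighbourhood inside the cap.\<close>
    let ?U = "(topspace Y - ?X') - (\<Union>g\<in>faces G - {f}. D g)"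
    have U: "openin Y ?U" using closedin_caps[of "faces G - {f}"] closedin_surf_image by blast
    have "?U \<subseteq> D f" using topspace_capped by blast
    moreover have "p \<in> ?U"
      using p 2 cap_meet[OF 2(1)] cap_disjoint[OF 2(1)] by blast
    moreover have "planar_at (subtopology Y (D f)) p"
      using 2 cap_boundary[OF 2(1)] p by (auto simp: disc_boundary_def surface_boundary_eq)
    ultimately show ?thesis using planar_at_open_piece[OF U] by blast
  next
    case 3
    let ?U = "topspace Y - (\<Union>g\<in>faces G. D g)"
    have U: "openin Y ?U" using closedin_caps[of "faces G"] by blast
    have "?U \<subseteq> ?X'" using topspace_capped by blast
    moreover have "p \<in> ?U" using p 3 by blast
    moreover have "p \<notin> i ` surface_boundary X"
      using 3 cap_meet unfolding Union_faces[symmetric] by blast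
    then have "p \<notin> surface_boundary (subtopology Y ?X')"
      using surface_boundary_homeomorphic_map[OF homeomorphic_map_surf] by simp
    then have "planar_at (subtopology Y ?X') p"
      using 3 p by (auto simp: surface_boundary_eq)
    ultimately show ?thesis using planar_at_open_piece[OF U] by blast
  qed
qed

lemma piece_image_disc: "d \<in> V \<union> E \<Longrightarrow> is_closed_disc Y (i ` d)"
  and piece_image_boundary: "d \<in> V \<union> E \<Longrightarrow> disc_boundary Y (i ` d) = i ` disc_boundary X d"
  using embedding_closed_disc[OF embedding piece_disc] by blast+

lemma piece_subset: "d \<in> V \<union> E \<Longrightarrow> d \<subseteq> topspace X"
  using topspace_surf by blast

text \<open>At a point off the circle of the piece, the image of \<open>d\<close> would contain a
  neighbourhood in \<open>Y\<close>. But each point of the cap is a limit of interior points of the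
  cap, and those lie outside the image of the surface.\<close>

lemma piece_cap_meet:
  assumes d: "d \<in> V \<union> E" and f: "f \<in> faces G"
  shows "i ` d \<inter> D f \<subseteq> disc_boundary Y (i ` d)"
proof
  fix p assume p: "p \<in> i ` d \<inter> D f"
  have pY: "p \<in> topspace Y" using p topspace_capped f by blast
  show "p \<in> disc_boundary Y (i ` d)"
  proof (rule ccontr)
    assume "p \<notin> disc_boundary Y (i ` d)"
    then have "planar_at (subtopology Y (i ` d)) p"
      using p pY by (auto simp: disc_boundary_def surface_boundary_eq)
    then obtain U where U: "openin Y U" "p \<in> U" "U \<subseteq> i ` d"
      using planar_at_subtopology_imp_interior[OF planar_at_capped[OF pY]] by blast
    have "p \<in> Y closure_of (D f - i ` f)"
      using disc_subset_closure_of_interior[OF cap_disc[OF f]] cap_boundary[OF f] p by auto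
    then obtain q where "q \<in> D f - i ` f" "q \<in> U"
      using U unfolding in_closure_of by blast
    then show False using U cap_meet[OF f] piece_subset[OF d] by blast
  qed
qed

lemma image_Int_subset_boundary:
  assumes "d \<in> V \<union> E" "d' \<in> V \<union> E" "d \<inter> d' \<subseteq> disc_boundary X d"
  shows "i ` d \<inter> i ` d' \<subseteq> disc_boundary Y (i ` d)"
  using assms piece_image_boundary[OF assms(1)] inj_on_surf piece_subset[OF assms(1)] piece_subset[OF assms(2)]
  by (metis image_mono inj_on_image_Int)

text \<open>The right-hand side is \<open>boundary_components\<close> of the dual subgraph written
  out in \<open>Y\<close>. Both subgraphs have the same boundary set in \<open>Y\<close>, so
  \<open>i\<close> carries the components on one side to those on the other.\<close>

lemma card_dual_boundary_components:
  assumes A: "A \<subseteq> E"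
  shows "card (boundary_components G A) =
    card (connected_components_of
      (let Z = subtopology Y (\<Union>(D ` faces G) \<union> \<Union>((`) i ` (E - A)))
       in subtopology Z (surface_boundary Z)))"
proof -
  define \<K> where "\<K> = (`) i ` (V \<union> A)"
  define \<L> where "\<L> = D ` faces G \<union> (`) i ` (E - A)"
  have fin: "finite \<K>" "finite \<L>"
    using finite_pieces finite_faces A by (auto simp: \<K>_def \<L>_def intro: finite_subset)
  have discK: "is_closed_disc Y d" if "d \<in> \<K>" for d
    using that piece_image_disc A by (auto simp: \<K>_def)
  have discL: "is_closed_disc Y d" if "d \<in> \<L>" for d
    using that piece_image_disc cap_disc by (auto simp: \<L>_def)
  have UK: "\<Union>\<K> = i ` (\<Union>V \<union> \<Union>A)" by (auto simp: \<K>_def)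
  have cover: "\<Union>\<K> \<union> \<Union>\<L> = topspace Y"
  proof -
    have "\<Union>E = \<Union>A \<union> \<Union>(E - A)" using A by blast
    then show ?thesis unfolding topspace_capped topspace_surf UK by (auto simp: \<L>_def)
  qed
  have pieces: "d \<inter> e \<subseteq> disc_boundary X d \<and> e \<inter> d \<subseteq> disc_boundary X e"
    if "d \<in> V \<union> A" "e \<in> E - A" for d e
  proof (cases "d \<in> V")
    case True
    then show ?thesis using vertex_edge_meet[of d e] that by blast
  next
    case False
    then have "d \<inter> e = {}" using that A disjointD[OF disjoint_pieces(2), of d e] by blast
    then show ?thesis by blast
  qed
  have meet: "d \<inter> d' \<subseteq> disc_boundary Y d \<and> d' \<inter> d \<subseteq> disc_boundary Y d'"
    if d: "d \<in> \<K>" and d': "d' \<in> \<L>" for d d'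
  proof -
    obtain c where c: "c \<in> V \<union> A" "d = i ` c" using d by (auto simp: \<K>_def)
    have cVE: "c \<in> V \<union> E" using c A by blast
    consider f where "f \<in> faces G" "d' = D f" | e where "e \<in> E - A" "d' = i ` e"
      using d' by (auto simp: \<L>_def)
    then show ?thesis
    proof cases
      case 1
      then show ?thesis
        using piece_cap_meet[OF cVE] cap_meet cap_boundary piece_subset[OF cVE] c by blast
    next
      case 2
      then show ?thesis
        using image_Int_subset_boundary[of c e] image_Int_subset_boundary[of e c] pieces[OF c(1)] cVE c
        by blast
    qed
  qed
  have bK: "surface_boundary (subtopology Y (\<Union>\<K>)) = \<Union>\<K> \<inter> \<Union>\<L>"
    by (rule surface_boundary_Union_closed_discs[OF Hausdorff_capped planar_at_capped fin])
      (use discK discL cover meet in blast)+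
  \<comment> \<open>The same lemma with the two families exchanged; this is why \<open>meet\<close>
    gives both inclusions.\<close>
  have bL: "surface_boundary (subtopology Y (\<Union>\<L>)) = \<Union>\<L> \<inter> \<Union>\<K>"
    by (rule surface_boundary_Union_closed_discs[OF Hausdorff_capped planar_at_capped fin(2,1)])
      (use discK discL cover meet in blast)+
  let ?S = "\<Union>V \<union> \<Union>A"
  have SX: "?S \<subseteq> topspace X" using A topspace_surf by blast
  let ?b = "surface_boundary (subtopology X ?S)"
  have h: "homeomorphic_map (subtopology X ?S) (subtopology Y (\<Union>\<K>)) i"
    unfolding UK by (rule homeomorphic_map_restrict_embedding[OF embedding SX])
  have bS: "?b \<subseteq> ?S" using surface_boundary_subset[of "subtopology X ?S"] by auto
  have ib: "i ` ?b = \<Union>\<K> \<inter> \<Union>\<L>"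
    using surface_boundary_homeomorphic_map[OF h] bK by simp
  have "homeomorphic_map (subtopology X ?b) (subtopology Y (\<Union>\<K> \<inter> \<Union>\<L>)) i"
    using homeomorphic_map_restrict_embedding[OF embedding subset_trans[OF bS SX]] ib by simp
  then have "connected_components_of (subtopology Y (\<Union>\<K> \<inter> \<Union>\<L>)) =
      (`) i ` connected_components_of (subtopology X ?b)"
    by (rule homeomorphic_map_connected_components_of)
  moreover have "inj_on ((`) i) (connected_components_of (subtopology X ?b))"
  proof (rule inj_on_subset[OF inj_on_image_Pow[OF inj_on_surf]])
    show "connected_components_of (subtopology X ?b) \<subseteq> Pow (topspace X)"
      using connected_components_of_subset by fastforce
  qed
  ultimately have "card (connected_components_of (subtopology Y (\<Union>\<K> \<inter> \<Union>\<L>))) =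
      card (connected_components_of (subtopology X ?b))"
    by (simp add: card_image)
  moreover have "boundary_components G A = connected_components_of (subtopology X ?b)"
    unfolding boundary_components_def Let_def
    using bS by (simp add: subtopology_subtopology inf_absorb2)
  moreover have "\<Union>(D ` faces G) \<union> \<Union>((`) i ` (E - A)) = \<Union>\<L>" by (auto simp: \<L>_def)
  ultimately show ?thesis
    unfolding Let_def using bL
    by (simp add: subtopology_subtopology inf_absorb2 Int_commute)
qed

end

section \<open>Ranks and the duality formula\<close>

lemma rtrancl_map_inj:
  assumes inj: "inj_on \<phi> N" and R: "R \<subseteq> N \<times> N" and xy: "x \<in> N" "y \<in> N"
  shows "(\<phi> x, \<phi> y) \<in> (map_prod \<phi> \<phi> ` R)\<^sup>* \<longleftrightarrow> (x, y) \<in> R\<^sup>*"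
proof
  assume "(x, y) \<in> R\<^sup>*"
  then show "(\<phi> x, \<phi> y) \<in> (map_prod \<phi> \<phi> ` R)\<^sup>*"
  proof induction
    case (step y z)
    then have "(\<phi> y, \<phi> z) \<in> map_prod \<phi> \<phi> ` R" by force
    then show ?case using step by (meson rtrancl.rtrancl_into_rtrancl)
  qed simp
next
  \<comment> \<open>The endpoint is generalised for the induction; injectivity ensures that the
    preimages chosen at consecutive steps of a path agree, so the path lifts.\<close>
  have "\<forall>y\<in>N. b = \<phi> y \<longrightarrow> (x, y) \<in> R\<^sup>*" if "(\<phi> x, b) \<in> (map_prod \<phi> \<phi> ` R)\<^sup>*" for b
    using that
  proof induction
    case base
    then show ?case using inj xy by (auto simp: inj_on_def)
  next
    case (step b c)
    then obtain u v where uv: "(u, v) \<in> R" "b = \<phi> u" "c = \<phi> v" by auto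
    have "u \<in> N" using uv R by blast
    then have "(x, u) \<in> R\<^sup>*" using step.IH uv by blast
    then have "(x, v) \<in> R\<^sup>*" using uv(1) by (rule rtrancl_into_rtrancl)
    moreover have "v \<in> N" using uv R by blast
    ultimately show ?case using inj uv by (auto simp: inj_on_def)
  qed
  moreover assume "(\<phi> x, \<phi> y) \<in> (map_prod \<phi> \<phi> ` R)\<^sup>*"
  ultimately show "(x, y) \<in> R\<^sup>*" using xy by blast
qed

text \<open>The rank depends on the edges only through the adjacency they generate. Matching ends
  transports this relation along \<open>\<phi>\<close>, so \<open>\<phi>\<close> maps the components
  bijectively to components.\<close>

lemma graph_rank_image:
  assumes inj: "inj_on \<phi> N" and ends: "\<And>e. e \<in> A \<Longrightarrow> ends e \<subseteq> N"
    and ends': "\<And>e. e \<in> A \<Longrightarrow> ends' (\<psi> e) = \<phi> ` ends e"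
  shows "graph_rank (\<phi> ` N) ends' (\<psi> ` A) = graph_rank N ends A"
proof -
  let ?R = "{(u, u'). \<exists>e\<in>A. u \<in> ends e \<and> u' \<in> ends e}"
  let ?R' = "{(u, u'). \<exists>e\<in>\<psi> ` A. u \<in> ends' e \<and> u' \<in> ends' e}"
  have RN: "?R \<subseteq> N \<times> N" using ends by blast
  have R': "?R' = map_prod \<phi> \<phi> ` ?R"
  proof
    show "?R' \<subseteq> map_prod \<phi> \<phi> ` ?R"
    proof clarify
      fix u u' e assume e: "e \<in> A" "u \<in> ends' (\<psi> e)" "u' \<in> ends' (\<psi> e)"
      then obtain v v' where "v \<in> ends e" "v' \<in> ends e" "u = \<phi> v" "u' = \<phi> v'"
        using ends' by auto
      then show "(u, u') \<in> map_prod \<phi> \<phi> ` ?R"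
        using e by (intro image_eqI[of _ _ "(v, v')"]) auto
    qed
    show "map_prod \<phi> \<phi> ` ?R \<subseteq> ?R'" using ends' by auto
  qed
  let ?C = "connection N ends A"
  have C': "(\<phi> x, \<phi> y) \<in> connection (\<phi> ` N) ends' (\<psi> ` A) \<longleftrightarrow> (x, y) \<in> ?C"
    if "x \<in> N" "y \<in> N" for x y
    unfolding connection_def R' using rtrancl_map_inj[OF inj RN that] that by auto
  have cls: "connection (\<phi> ` N) ends' (\<psi> ` A) `` {\<phi> x} = \<phi> ` (?C `` {x})" if x: "x \<in> N" for x
  proof
    show "connection (\<phi> ` N) ends' (\<psi> ` A) `` {\<phi> x} \<subseteq> \<phi> ` (?C `` {x})"
    proof
      fix b assume b: "b \<in> connection (\<phi> ` N) ends' (\<psi> ` A) `` {\<phi> x}"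
      then obtain y where y: "y \<in> N" "b = \<phi> y" by (auto simp: connection_def)
      then show "b \<in> \<phi> ` (?C `` {x})" using C'[OF x y(1)] b by blast
    qed
    show "\<phi> ` (?C `` {x}) \<subseteq> connection (\<phi> ` N) ends' (\<psi> ` A) `` {\<phi> x}"
    proof
      fix b assume "b \<in> \<phi> ` (?C `` {x})"
      then obtain y where y: "(x, y) \<in> ?C" "b = \<phi> y" by blast
      then have "y \<in> N" by (simp add: connection_def)
      then show "b \<in> connection (\<phi> ` N) ends' (\<psi> ` A) `` {\<phi> x}" using C'[OF x] y by blast
    qed
  qed
  have "\<phi> ` N // connection (\<phi> ` N) ends' (\<psi> ` A) = (`) \<phi> ` (N // ?C)"
    unfolding quotient_def using cls by auto
  moreover have "inj_on ((`) \<phi>) (N // ?C)"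
    by (rule inj_on_subset[OF inj_on_image_Pow[OF inj]]) (auto simp: quotient_def connection_def)
  ultimately show ?thesis
    using inj by (simp add: graph_rank_def card_image)
qed

text \<open>Serves both colourings: \<open>\<phi>\<close> is the cap map \<open>D\<close> for
  boundary classes, and the map from a vertex to the image of its circle for vertex classes.\<close>

lemma dual_rank:
  fixes \<phi> :: "'a set \<Rightarrow> 'b set" and i :: "'a \<Rightarrow> 'b"
  assumes inj: "inj_on \<phi> (\<Union>P)"
    and meet: "\<And>c e. c \<in> \<Union>P \<Longrightarrow> e \<in> A \<Longrightarrow> \<phi> c \<inter> i ` e \<noteq> {} \<longleftrightarrow> c \<inter> e \<noteq> {}"
  shows "graph_rank ((`) \<phi> ` P) (classes_at ((`) \<phi> ` P)) ((`) i ` A) =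
    graph_rank P (classes_at P) A"
proof (rule graph_rank_image)
  show "inj_on ((`) \<phi>) P"
    by (rule inj_on_subset[OF inj_on_image_Pow[OF inj]]) auto
  show "classes_at P e \<subseteq> P" for e by (auto simp: classes_at_def)
  fix e assume e: "e \<in> A"
  have "classes_at ((`) \<phi> ` P) (i ` e) = (`) \<phi> ` {C \<in> P. \<exists>c\<in>C. \<phi> c \<inter> i ` e \<noteq> {}}"
    unfolding classes_at_def by blast
  also have "{C \<in> P. \<exists>c\<in>C. \<phi> c \<inter> i ` e \<noteq> {}} = classes_at P e"
    unfolding classes_at_def using meet[OF _ e] by (intro Collect_cong conj_cong bex_cong) auto
  finally show "classes_at ((`) \<phi> ` P) (i ` e) = (`) \<phi> ` classes_at P e" .
qed

section \<open>Incidences of edges with caps and vertex circles\<close>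

context capped_ribbon
begin

lemma inj_on_edge_image: "inj_on ((`) i) E"
  by (rule inj_on_subset[OF inj_on_image_Pow[OF inj_on_surf]]) (use piece_subset in blast)

lemma inj_on_caps: "inj_on D (faces G)"
proof (rule inj_onI)
  fix f g assume fg: "f \<in> faces G" "g \<in> faces G" "D f = D g"
  then have "D f \<inter> D g \<noteq> {}" using closed_disc_nonempty cap_disc by blast
  then show "f = g" using cap_disjoint fg by blast
qed

lemma cap_edge_meet:
  assumes "f \<in> faces G" "e \<in> E"
  shows "D f \<inter> i ` e \<noteq> {} \<longleftrightarrow> f \<inter> e \<noteq> {}"
proof -
  have "D f \<inter> i ` e = i ` f \<inter> i ` e"
    using cap_meet[OF assms(1)] piece_subset[of e] assms(2) by blast
  also have "\<dots> = i ` (f \<inter> e)"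
    using inj_on_image_Int[OF inj_on_surf face_subset[OF assms(1)], of e] piece_subset[of e] assms(2)
    by blast
  finally show ?thesis by simp
qed

text \<open>An edge meets a vertex only on the vertex circle, so no incidence is lost when the
  vertex is replaced by its circle, the corresponding boundary component of the dual.\<close>

lemma vertex_circle_edge_meet:
  assumes "v \<in> V" "e \<in> E"
  shows "i ` disc_boundary X v \<inter> i ` e \<noteq> {} \<longleftrightarrow> v \<inter> e \<noteq> {}"
proof -
  have "i ` disc_boundary X v \<inter> i ` e = i ` (disc_boundary X v \<inter> e)"
    using inj_on_image_Int[OF inj_on_surf, of "disc_boundary X v" e] disc_boundary_subset[of X v]
      piece_subset[of v] piece_subset[of e] assms by blast
  moreover have "disc_boundary X v \<inter> e = v \<inter> e"
    using vertex_edge_meet[OF assms] disc_boundary_subset[of X v] by blast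
  ultimately show ?thesis by simp
qed

lemma inj_on_vertex_circle: "inj_on (\<lambda>v. i ` disc_boundary X v) V"
proof (rule inj_onI)
  fix v w assume vw: "v \<in> V" "w \<in> V" "i ` disc_boundary X v = i ` disc_boundary X w"
  have "disc_boundary X u \<subseteq> topspace X" if "u \<in> V" for u
    using that disc_boundary_subset[of X u] piece_subset[of u] by blast
  then have "disc_boundary X v = disc_boundary X w"
    using inj_on_image_eq_iff[OF inj_on_surf, of "disc_boundary X v" "disc_boundary X w"] vw by simp
  then show "v = w" using inj_on_disc_boundary vw by (meson inj_onD)
qed

end

section \<open>Exchange of the parameters and of the exponents\<close>

text \<open>The two \<open>rho\<close> equations have the form in which \<open>r2\<close> and
  \<open>r4\<close> need them: after cancelling the class ranks, they turn a difference of
  \<open>r2\<close> in the dual into \<open>r4\<close> in \<open>G\<close>, and \<open>r4\<close> in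
  the dual into a difference of \<open>r2\<close> in \<open>G\<close>.\<close>

lemma dual_parameters:
  fixes G :: "('a, 'm) coloured_ribbon_graph_scheme"
    and H :: "('b, 'n) coloured_ribbon_graph_scheme"
  assumes G: "is_coloured_ribbon_graph G" and H: "is_dual G H"
  obtains i where "edges H = (`) i ` edges G" "inj_on ((`) i) (edges G)"
    "\<And>A. A \<subseteq> edges G \<Longrightarrow> vertex_rank H ((`) i ` A) = boundary_rank G A"
    "\<And>A. A \<subseteq> edges G \<Longrightarrow> boundary_rank H ((`) i ` A) = vertex_rank G A"
    "\<And>A. A \<subseteq> edges G \<Longrightarrow> rho H (edges H) - rho H ((`) i ` (edges G - A)) = of_nat (card A) - rho G A"
    "\<And>A. A \<subseteq> edges G \<Longrightarrow>
       of_nat (card (edges G - A)) - rho H ((`) i ` (edges G - A)) = rho G (edges G) - rho G A"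
proof -
  obtain Y i D where dual: "is_geometric_dual_via G H Y i D"
    and vc: "vertex_classes H = (\<lambda>C. D ` C) ` boundary_classes G"
    and bc: "boundary_classes H = (\<lambda>C. (\<lambda>v. i ` disc_boundary (surf G) v) ` C) ` vertex_classes G"
    using H unfolding is_dual_def by (elim exE conjE) (rule that)
  have cap: "capping_off G Y i D" and vH: "verts H = D ` faces G"
    and eH: "edges H = (`) i ` edges G"
    and sH: "surf H = subtopology Y (\<Union>(verts H) \<union> \<Union>(edges H))"
    using dual by (simp_all add: is_geometric_dual_via_def)
  interpret capped_ribbon G Y i D
    using G cap by unfold_locales (auto simp: is_coloured_ribbon_graph_def)
  have UB: "\<Union>(boundary_classes G) = faces G" and UV: "\<Union>(vertex_classes G) = V"
    using G by (auto simp: is_coloured_ribbon_graph_def partition_on_def)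
  have bcH: "card (boundary_components H ((`) i ` (E - A))) = card (boundary_components G A)"
    if A: "A \<subseteq> E" for A
  proof -
    \<comment> \<open>The surface of \<open>H\<close> is itself a subspace of \<open>Y\<close>, so
      the nested restriction to a subgraph of \<open>H\<close> must collapse to a single restriction
      of \<open>Y\<close>.\<close>
    have "(\<Union>(verts H) \<union> \<Union>(edges H)) \<inter> (\<Union>(verts H) \<union> \<Union>((`) i ` (E - A))) =
        \<Union>(D ` faces G) \<union> \<Union>((`) i ` (E - A))"
      unfolding eH vH by blast
    then show ?thesis
      unfolding card_dual_boundary_components[OF A] boundary_components_def[of H] sH
      by (simp only: Let_def subtopology_subtopology vH[symmetric])
  qed
  have cE: "card ((`) i ` A) = card A" if "A \<subseteq> E" for A
    using inj_on_edge_image that by (meson card_image inj_on_subset)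
  have cV: "card (verts H) = card (faces G)" using vH inj_on_caps by (simp add: card_image)
  have fin: "finite E" by (rule finite_pieces)
  have cD: "of_nat (card (E - A)) = (of_nat (card E) - of_nat (card A) :: rat)" if "A \<subseteq> E" for A
    using that fin by (simp add: card_Diff_subset finite_subset of_nat_diff card_mono)
  have rhoH: "rho H ((`) i ` (E - A)) =
      (of_nat (card E) - of_nat (card A) + of_nat (card (faces G)) - of_nat (card (boundary_components G A))) / 2"
    if A: "A \<subseteq> E" for A
    unfolding rho_def bcH[OF A] cV using cE[of "E - A"] cD[OF A] by simp
  \<comment> \<open>The instance with no edges on the side of \<open>G\<close>, which brings in |V|
    as the number of boundary components of the whole dual.\<close>
  have rhoHE: "rho H (edges H) =
      (of_nat (card E) + of_nat (card (faces G)) - of_nat (card V)) / 2"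
    using rhoH[of "{}"] eH card_boundary_components_no_edges by simp
  show thesis
  proof (rule that[OF eH inj_on_edge_image])
    fix A assume A: "A \<subseteq> E"
    show "vertex_rank H ((`) i ` A) = boundary_rank G A"
      unfolding vertex_rank_def boundary_rank_def vc
      by (rule dual_rank, simp add: UB inj_on_caps, rule cap_edge_meet) (use A UB in auto)
    show "boundary_rank H ((`) i ` A) = vertex_rank G A"
      unfolding vertex_rank_def boundary_rank_def bc
      by (rule dual_rank, simp add: UV inj_on_vertex_circle, rule vertex_circle_edge_meet)
        (use A UV in auto)
    show "rho H (edges H) - rho H ((`) i ` (E - A)) = of_nat (card A) - rho G A"
      unfolding rhoH[OF A] rhoHE rho_def[of G] by (simp add: field_simps)
    show "of_nat (card (E - A)) - rho H ((`) i ` (E - A)) = rho G E - rho G A"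
      unfolding rhoH[OF A] cD[OF A] rho_def[of G] by (simp add: field_simps)
  qed
qed

theorem theorem3p8:
  fixes G :: "'a coloured_ribbon_graph"
    and G_dual :: "'b coloured_ribbon_graph"
    and w x y z :: 'v
  assumes "is_coloured_ribbon_graph G"
    and "is_dual G G_dual"
  shows "T_ps G_dual w x y z = T_ps G y z w x"
proof -
  obtain i where eH: "edges G_dual = (`) i ` edges G" and inj: "inj_on ((`) i) (edges G)"
    and vr: "\<And>A. A \<subseteq> edges G \<Longrightarrow> vertex_rank G_dual ((`) i ` A) = boundary_rank G A"
    and br: "\<And>A. A \<subseteq> edges G \<Longrightarrow> boundary_rank G_dual ((`) i ` A) = vertex_rank G A"
    and rho1: "\<And>A. A \<subseteq> edges G \<Longrightarrow>
      rho G_dual (edges G_dual) - rho G_dual ((`) i ` (edges G - A)) = of_nat (card A) - rho G A"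
    and rho2: "\<And>A. A \<subseteq> edges G \<Longrightarrow> of_nat (card (edges G - A)) - rho G_dual ((`) i ` (edges G - A)) =
      rho G (edges G) - rho G A"
    using dual_parameters[OF assms] by metis
  let ?E = "edges G" and ?H = G_dual
  let ?h = "\<lambda>A. (`) i ` (?E - A)"
  have bij: "bij_betw ?h (Pow ?E) (Pow (edges ?H))"
  proof -
    have "bij_betw (\<lambda>A. ?E - A) (Pow ?E) (Pow ?E)"
      by (rule bij_betwI[of _ _ _ "\<lambda>A. ?E - A"]) auto
    moreover have "bij_betw ((`) ((`) i)) (Pow ?E) (Pow (edges ?H))"
      unfolding eH using inj by (simp add: bij_betw_def inj_on_image_Pow image_Pow_surj)
    ultimately show ?thesis
      using bij_betw_trans by (fastforce simp: comp_def)
  qed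
  have exps: "r1 ?H (edges ?H) - r1 ?H (?h A) = r3 G A"
    "r2 ?H (edges ?H) - r2 ?H (?h A) = r4 G A"
    "r3 ?H (?h A) = r1 G ?E - r1 G A"
    "r4 ?H (?h A) = r2 G ?E - r2 G A" if A: "A \<subseteq> ?E" for A
  proof -
    have sub: "?E - A \<subseteq> ?E" by blast
    \<comment> \<open>The parameters \<open>r3\<close> and \<open>r4\<close> of the dual already
      contain a complement; the two complements cancel and leave the boundary rank of the dual at
      the image of \<open>A\<close>, which is the vertex rank of \<open>A\<close> in
      \<open>G\<close>.\<close>
    have diff: "edges ?H - ?h A = (`) i ` A"
      unfolding eH using inj_on_image_set_diff[OF inj Diff_subset sub] A by (simp add: double_diff)
    have card: "card (?h A) = card (?E - A)"
      using inj sub by (meson card_image inj_on_subset)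
    have vrE: "vertex_rank ?H (edges ?H) = boundary_rank G ?E"
      and brE: "boundary_rank ?H (edges ?H) = vertex_rank G ?E"
      unfolding eH using vr br by auto
    show "r1 ?H (edges ?H) - r1 ?H (?h A) = r3 G A"
      by (simp add: r1_def r3_def vrE vr[OF sub])
    show "r2 ?H (edges ?H) - r2 ?H (?h A) = r4 G A"
      using rho1[OF A] by (simp add: r2_def r4_def vrE vr[OF sub])
    show "r3 ?H (?h A) = r1 G ?E - r1 G A"
      by (simp add: r1_def r3_def brE diff br[OF A])
    show "r4 ?H (?h A) = r2 G ?E - r2 G A"
      using rho2[OF A] by (simp add: r2_def r4_def brE diff br[OF A] card)
  qed
  have "T_ps ?H w x y z = (\<Sum>A\<in>Pow ?E.
        var_pow w (r1 ?H (edges ?H) - r1 ?H (?h A)) * var_pow x (r2 ?H (edges ?H) - r2 ?H (?h A)) *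
        var_pow y (r3 ?H (?h A)) * var_pow z (r4 ?H (?h A)))"
    unfolding T_ps_def by (rule sum.reindex_bij_betw[OF bij, symmetric])
  \<comment> \<open>Summand by summand, the exponents of \<open>w\<close>, \<open>x\<close> and of
    \<open>y\<close>, \<open>z\<close> have traded places, so only the order of the factors
    differs.\<close>
  also have "\<dots> = T_ps G y z w x"
    unfolding T_ps_def
    by (rule sum.cong) (auto simp: exps mult_ac)
  finally show ?thesis .
qed

end
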